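(* Let $\mathcal{T}$, $h\in H$, $\emptyset\ne\mathcal{I}\subset\mathcal{V}$ and $\mathcal{T}\setminus\mathcal{I}=\bigcup_i\mathcal{T}_i$ be as in the context. There is $N$ such that for every $l'_0=\sum_{v\in\mathcal{V}}a_vE_v^*\in L'$ with $[l'_0]=h$ and $a_v\ge N$ for all $v$, $$Q^{\mathcal{T}}_{[l'_0]}(l'_0)=Q^{\mathcal{T}}_{[l'_0],\mathcal{I}}(l'_0)+\sum_i Q^{\mathcal{T}_i}_{[j_i^*(l'_0)]}\big(j_i^*(l'_0)\big).$$
   Context: $\mathcal{T}$ is a connected plumbing graph which is a tree with all genus decorations $0$ and negative definite intersection matrix; $\mathcal{V}$ its vertex set, $\delta_v$ the valency. $L=\mathbb{Z}\langle E_v\rangle_{v\in\mathcal{V}}$ with the intersection form $(\,,\,)$, $L'=\{l'\in L\otimes\mathbb{Q}:(l',L)\subset\mathbb{Z}\}$ with basis $E_v^*$, $(E_v^*,E_w)=-\delta_{vw}$; $H=L'/L$, $[x]$ is the class of $x$. For $x=\sum x_vE_v$, $x|_{\mathcal{I}}=\sum_{v\in\mathcal{I}}x_vE_v$; $\ge$ is the coordinatewise order. $Z(\mathbf{t})=\sum_{l'}z^{\mathcal{T}}(l')\mathbf{t}^{l'}$ is the Taylor expansion of $\prod_v(1-\mathbf{t}^{E_v^*})^{\delta_v-2}$ ($\mathbf{t}^{l'}=\prod t_v^{l'_v}$). Counting functions: for $x\in L'$ with $[x]=h$, $Q^{\mathcal{T}}_h(x)=\sum_{l'\not\ge x,[l']=h}z^{\mathcal{T}}(l')$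 and $Q^{\mathcal{T}}_{h,\mathcal{I}}(x)=\sum_{l'|_{\mathcal{I}}\not\ge x|_{\mathcal{I}},[l']=h}z^{\mathcal{T}}(l')$ (finite sums). The $\mathcal{T}_i$ are the connected components of the full subgraph on $\mathcal{V}\setminus\mathcal{I}$; $Q^{\mathcal{T}_i}$ denotes the counting function defined analogously for $\mathcal{T}_i$ with its own lattices and series; $j_i^*:L'(\mathcal{T})\to L'(\mathcal{T}_i)$ is linear with $j_i^*(E_v^* )=E_v^*(\mathcal{T}_i)$ if $v\in\mathcal{V}(\mathcal{T}_i)$ and $0$ otherwise. *)

theory Defs
  imports Complex_Main
begin

text \<open>
Plumbing graph data: a vertex set S (finite), a symmetric irreflexive adjacency
relation Adj on the ambient type, Euler decorations e (integers); all genera are 0.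
Elements of L tensor Q are rational coordinate vectors x :: 'a => rat with
respect to the basis E_v, supported on S.  Subgraphs (the T_i) are given by
the same Adj and e restricted to a vertex subset.
\<close>

definition edges :: "'a set \<Rightarrow> ('a \<Rightarrow> 'a \<Rightarrow> bool) \<Rightarrow> 'a set set" where
  "edges S Adj = {{v, w} | v w. v \<in> S \<and> w \<in> S \<and> Adj v w}"

definition reach :: "'a set \<Rightarrow> ('a \<Rightarrow> 'a \<Rightarrow> bool) \<Rightarrow> 'a \<Rightarrow> 'a \<Rightarrow> bool" where
  "reach S Adj = (\<lambda>a b. a \<in> S \<and> b \<in> S \<and> Adj a b)\<^sup>*\<^sup>*"

definition is_tree :: "'a set \<Rightarrow> ('a \<Rightarrow> 'a \<Rightarrow> bool) \<Rightarrow> bool" where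
  "is_tree S Adj \<longleftrightarrow> finite S \<and> S \<noteq> {} \<and>
     (\<forall>v w. Adj v w \<longrightarrow> Adj w v) \<and> (\<forall>v. \<not> Adj v v) \<and>
     (\<forall>v\<in>S. \<forall>w\<in>S. reach S Adj v w) \<and> card (edges S Adj) + 1 = card S"

definition components :: "'a set \<Rightarrow> ('a \<Rightarrow> 'a \<Rightarrow> bool) \<Rightarrow> 'a set set" where
  "components S Adj = {{w \<in> S. reach S Adj v w} | v. v \<in> S}"

definition valency :: "'a set \<Rightarrow> ('a \<Rightarrow> 'a \<Rightarrow> bool) \<Rightarrow> 'a \<Rightarrow> nat" where
  "valency S Adj v = card {w \<in> S. Adj v w}"

definition imat :: "('a \<Rightarrow> 'a \<Rightarrow> bool) \<Rightarrow> ('a \<Rightarrow> int) \<Rightarrow> 'a \<Rightarrow> 'a \<Rightarrow> int" where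
  "imat Adj e v w = (if v = w then e v else if Adj v w then 1 else 0)"

definition neg_definite :: "'a set \<Rightarrow> ('a \<Rightarrow> 'a \<Rightarrow> bool) \<Rightarrow> ('a \<Rightarrow> int) \<Rightarrow> bool" where
  "neg_definite S Adj e \<longleftrightarrow> (\<forall>x :: 'a \<Rightarrow> real. (\<exists>v\<in>S. x v \<noteq> 0) \<longrightarrow>
      (\<Sum>v\<in>S. \<Sum>w\<in>S. x v * x w * of_int (imat Adj e v w)) < 0)"

definition ip :: "'a set \<Rightarrow> ('a \<Rightarrow> 'a \<Rightarrow> bool) \<Rightarrow> ('a \<Rightarrow> int) \<Rightarrow> ('a \<Rightarrow> rat) \<Rightarrow> ('a \<Rightarrow> rat) \<Rightarrow> rat" where
  "ip S Adj e x y = (\<Sum>v\<in>S. \<Sum>w\<in>S. x v * y w * of_int (imat Adj e v w))"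

definition supp_in :: "'a set \<Rightarrow> ('a \<Rightarrow> rat) \<Rightarrow> bool" where
  "supp_in S x \<longleftrightarrow> (\<forall>v. v \<notin> S \<longrightarrow> x v = 0)"

definition Ebas :: "'a \<Rightarrow> 'a \<Rightarrow> rat" where
  "Ebas v = (\<lambda>u. if u = v then 1 else 0)"

definition Ldual :: "'a set \<Rightarrow> ('a \<Rightarrow> 'a \<Rightarrow> bool) \<Rightarrow> ('a \<Rightarrow> int) \<Rightarrow> ('a \<Rightarrow> rat) set" where
  "Ldual S Adj e = {x. supp_in S x \<and> (\<forall>w\<in>S. ip S Adj e x (Ebas w) \<in> \<int>)}"

text \<open>x and y have the same class in H = L'/L\<close>
definition same_class :: "'a set \<Rightarrow> ('a \<Rightarrow> rat) \<Rightarrow> ('a \<Rightarrow> rat) \<Rightarrow> bool" where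
  "same_class S x y \<longleftrightarrow> (\<forall>v\<in>S. x v - y v \<in> \<int>)"

definition Estar :: "'a set \<Rightarrow> ('a \<Rightarrow> 'a \<Rightarrow> bool) \<Rightarrow> ('a \<Rightarrow> int) \<Rightarrow> 'a \<Rightarrow> 'a \<Rightarrow> rat" where
  "Estar S Adj e v = (THE x. supp_in S x \<and>
      (\<forall>w\<in>S. ip S Adj e x (Ebas w) = (if v = w then -1 else 0)))"

text \<open>coefficients a_v of l' = sum a_v E_v^*\<close>
definition dcoef :: "'a set \<Rightarrow> ('a \<Rightarrow> 'a \<Rightarrow> bool) \<Rightarrow> ('a \<Rightarrow> int) \<Rightarrow> ('a \<Rightarrow> rat) \<Rightarrow> 'a \<Rightarrow> rat" where
  "dcoef S Adj e x v = - ip S Adj e x (Ebas v)"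

text \<open>Taylor coefficients of Z(t) = prod_v (1 - t^{E_v^*})^(delta_v - 2):
  the coefficient of t^{l'} is the sum over exponent tuples k (k_v = power of t^{E_v^*})
  with sum_v k_v E_v^* = l' of prod_v [x^{k_v}] (1-x)^(delta_v - 2).\<close>
definition zcoef :: "'a set \<Rightarrow> ('a \<Rightarrow> 'a \<Rightarrow> bool) \<Rightarrow> ('a \<Rightarrow> int) \<Rightarrow> ('a \<Rightarrow> rat) \<Rightarrow> rat" where
  "zcoef S Adj e l =
     (\<Sum>k\<in>{k :: 'a \<Rightarrow> nat. (\<forall>v. v \<notin> S \<longrightarrow> k v = 0) \<and>
              (\<lambda>u. \<Sum>v\<in>S. of_nat (k v) * Estar S Adj e v u) = l}.
        \<Prod>v\<in>S. (-1) ^ k v * ((of_int (int (valency S Adj v) - 2) :: rat) gchoose k v))"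

text \<open>counting function Q_h(x), h = [x]; the (finite) sum is taken over the
  support of z, which does not change its value\<close>
definition Qcount :: "'a set \<Rightarrow> ('a \<Rightarrow> 'a \<Rightarrow> bool) \<Rightarrow> ('a \<Rightarrow> int) \<Rightarrow> ('a \<Rightarrow> rat) \<Rightarrow> rat" where
  "Qcount S Adj e x = (\<Sum>l\<in>{l. zcoef S Adj e l \<noteq> 0 \<and> same_class S l x \<and>
                                 \<not> (\<forall>v\<in>S. x v \<le> l v)}. zcoef S Adj e l)"

definition QcountI :: "'a set \<Rightarrow> ('a \<Rightarrow> 'a \<Rightarrow> bool) \<Rightarrow> ('a \<Rightarrow> int) \<Rightarrow> 'a set \<Rightarrow> ('a \<Rightarrow> rat) \<Rightarrow> rat" where
  "QcountI S Adj e I x = (\<Sum>l\<in>{l. zcoef S Adj e l \<noteq> 0 \<and> same_class S l x \<and>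
                                 \<not> (\<forall>v\<in>I. x v \<le> l v)}. zcoef S Adj e l)"

text \<open>j^*: L'(T) -> L'(T_C), linear with j^*(E_v^*) = E_v^*(T_C) for v in C, 0 otherwise\<close>
definition jstar :: "'a set \<Rightarrow> 'a set \<Rightarrow> ('a \<Rightarrow> 'a \<Rightarrow> bool) \<Rightarrow> ('a \<Rightarrow> int) \<Rightarrow> ('a \<Rightarrow> rat) \<Rightarrow> 'a \<Rightarrow> rat" where
  "jstar S C Adj e x = (\<lambda>u. \<Sum>v\<in>C. dcoef S Adj e x v * Estar C Adj e v u)"

end

theory Submission
  imports Defs "HOL-Library.FuncSet"
begin

text \<open>
Write \<open>l' = l'\<^sub>0 + y\<close> with \<open>y\<close> in \<open>L\<close> and \<open>k\<^sub>v(y) = a\<^sub>v - (y, E\<^sub>v)\<close>. There is a quadratic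
potential \<open>W\<close> on \<open>L\<close> with \<open>W(0) = 0\<close> and \<open>W(y + E\<^sub>v) - W(y) = k\<^sub>v(y) + 1\<close>. On a tree, leaf
induction expresses the coefficient \<open>z(l')\<close> as the alternating sum over \<open>J\<close> of the maxima of \<open>W\<close>
on the cubes \<open>(y, J)\<close> with lower corner \<open>y\<close> and directions \<open>J\<close>. Hence the difference of the two
counting functions of the big graph is an alternating sum over the cubes in a large box with
\<open>y \<ge> 0\<close> on \<open>I\<close>, minus the same sum over the nonnegative part. When all \<open>a\<^sub>v \<ge> -e\<^sub>v\<close>, negative
definiteness provides, for every nonzero upper bound \<open>u \<ge> 0\<close> of a box, a top layer \<open>y\<^sub>v = u\<^sub>v\<close>
entered with increasing \<open>W\<close>; removing it does not change the sum, so the box collapses to \<open>y = 0\<close> on \<open>I\<close>,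
\<open>y \<le> 0\<close> elsewhere. There \<open>W\<close> is the sum of the potentials of the components of the complement
of \<open>I\<close>, and the same collapse applied to each component identifies the summands.
\<close>

subsection \<open>Alternating sums of maxima over a cube\<close>

text \<open>If all edges of a cube in direction \<open>v\<close> are monotone in the same sense, the
  maximum over the cube is attained on one of the two faces orthogonal to \<open>v\<close>. This and
  the decreasing case eliminate a direction from a maximum.\<close>

lemma Max_Pow_insert_increasing:
  fixes g :: "'a set \<Rightarrow> rat"
  assumes "finite J" and "\<And>K. K \<subseteq> J \<Longrightarrow> g K \<le> g (insert v K)"
  shows "Max (g ` Pow (insert v J)) = Max ((\<lambda>K. g (insert v K)) ` Pow J)"
proof (rule antisym)
  show "Max (g ` Pow (insert v J)) \<le> Max ((\<lambda>K. g (insert v K)) ` Pow J)"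
  proof (rule Max.boundedI)
    fix x assume "x \<in> g ` Pow (insert v J)"
    then obtain K where K: "x = g K" "K \<subseteq> insert v J" by auto
    have "x \<le> g (insert v (K - {v}))"
      using K assms(2)[of "K - {v}"] by (cases "v \<in> K") (auto simp: insert_absorb subset_insert_iff)
    also have "\<dots> \<le> Max ((\<lambda>K. g (insert v K)) ` Pow J)"
      using K(2) assms(1) by (intro Max_ge imageI[of "K - {v}"]) auto
    finally show "x \<le> Max ((\<lambda>K. g (insert v K)) ` Pow J)" .
  qed (use assms(1) in auto)
  show "Max ((\<lambda>K. g (insert v K)) ` Pow J) \<le> Max (g ` Pow (insert v J))"
    by (rule Max_mono) (use assms(1) in auto)
qed

lemma Max_Pow_insert_decreasing:
  fixes g :: "'a set \<Rightarrow> rat"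
  assumes "finite J" and "\<And>K. K \<subseteq> J \<Longrightarrow> g (insert v K) \<le> g K"
  shows "Max (g ` Pow (insert v J)) = Max (g ` Pow J)"
proof (rule antisym)
  show "Max (g ` Pow (insert v J)) \<le> Max (g ` Pow J)"
  proof (rule Max.boundedI)
    fix x assume "x \<in> g ` Pow (insert v J)"
    then obtain K where K: "x = g K" "K \<subseteq> insert v J" by auto
    have "x \<le> g (K - {v})"
      using K assms(2)[of "K - {v}"] by (cases "v \<in> K") (auto simp: insert_absorb subset_insert_iff)
    also have "\<dots> \<le> Max (g ` Pow J)"
      using K assms(1) by (intro Max_ge) auto
    finally show "x \<le> Max (g ` Pow J)" .
  qed (use assms(1) in auto)
  show "Max (g ` Pow J) \<le> Max (g ` Pow (insert v J))"
    by (rule Max_mono) (use assms(1) in auto)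
qed

text \<open>\<open>Pow J\<close> is the vertex set of a face of a cube with lower corner
  \<open>{}\<close>. The sign makes the value for a single vertex equal to
  \<open>max 0 (g {v} - g {})\<close>.\<close>

definition alt_max :: "('a set \<Rightarrow> rat) \<Rightarrow> 'a set \<Rightarrow> rat" where
  "alt_max g S = (\<Sum>J\<in>Pow S. (-1) ^ (card J + 1) * Max (g ` Pow J))"

lemma alt_max_insert:
  assumes "finite S" "v \<notin> S"
  shows "alt_max g (insert v S) =
    (\<Sum>J\<in>Pow S. (-1) ^ (card J + 1) * (Max (g ` Pow J) - Max (g ` Pow (insert v J))))"
proof -
  have inj: "inj_on (insert v) (Pow S)"
    using assms(2) by (auto simp: inj_on_def)
  have "alt_max g (insert v S) = (\<Sum>J\<in>Pow S. (-1) ^ (card J + 1) * Max (g ` Pow J))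
      + (\<Sum>J\<in>insert v ` Pow S. (-1) ^ (card J + 1) * Max (g ` Pow J))"
    unfolding alt_max_def Pow_insert using assms by (intro sum.union_disjoint) auto
  also have "(\<Sum>J\<in>insert v ` Pow S. (-1) ^ (card J + 1) * Max (g ` Pow J)) =
      (\<Sum>J\<in>Pow S. (-1) ^ (card (insert v J) + 1) * Max (g ` Pow (insert v J)))"
    using inj by (simp add: sum.reindex)
  also have "\<dots> = (\<Sum>J\<in>Pow S. - ((-1) ^ (card J + 1) * Max (g ` Pow (insert v J))))"
  proof (intro sum.cong refl)
    fix J assume "J \<in> Pow S"
    then have "finite J" "v \<notin> J" using assms finite_subset by auto
    then show "(-1) ^ (card (insert v J) + 1) * Max (g ` Pow (insert v J)) =
      - ((-1) ^ (card J + 1) * Max (g ` Pow (insert v J)))" by simp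
  qed
  finally show ?thesis
    by (simp add: right_diff_distrib sum_subtractf sum_negf)
qed

text \<open>The faces \<open>J\<close> and \<open>insert v J\<close> have equal maxima and opposite
  signs, so they cancel in pairs.\<close>

lemma alt_max_eq_0:
  assumes "finite S" "v \<in> S" and "\<And>K. K \<subseteq> S - {v} \<Longrightarrow> g (insert v K) \<le> g K"
  shows "alt_max g S = 0"
proof -
  have S: "S = insert v (S - {v})" using assms(2) by auto
  have "alt_max g (insert v (S - {v})) = 0"
  proof (subst alt_max_insert, goal_cases)
    case 3
    show ?case
    proof (rule sum.neutral, rule ballI)
      fix J assume J: "J \<in> Pow (S - {v})"
      then have "finite J" using assms(1) finite_subset by (metis PowD finite_Diff)
      have "Max (g ` Pow (insert v J)) = Max (g ` Pow J)"
        by (rule Max_Pow_insert_decreasing) (use J assms(3) \<open>finite J\<close> in auto)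
      then show "(-1) ^ (card J + 1) * (Max (g ` Pow J) - Max (g ` Pow (insert v J))) = 0" by simp
    qed
  qed (use assms(1) in auto)
  then show ?thesis using S by simp
qed

section \<open>Taylor coefficients of \<open>(1 - x)^m\<close> and their products over a
  tree\<close>

text \<open>The coefficient of \<open>x^k\<close> in \<open>(1 - x)^m\<close>. The value 0 for
  negative \<open>k\<close> allows arbitrary integer dual coordinates as exponents.\<close>

definition binom_coef :: "int \<Rightarrow> int \<Rightarrow> rat" where
  "binom_coef m k = (if k < 0 then 0 else (-1) ^ nat k * (of_int m gchoose nat k))"

lemma binom_coef_neg [simp]: "k < 0 \<Longrightarrow> binom_coef m k = 0"
  by (simp add: binom_coef_def)

text \<open>Comparison of coefficients in
  \<open>(1 - x)^(m + 1) = (1 - x) * (1 - x)^m\<close>.\<close>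

lemma binom_coef_succ: "binom_coef (m + 1) k = binom_coef m k - binom_coef m (k - 1)"
proof (cases "k \<le> 0")
  case True
  then show ?thesis by (cases "k = 0") (auto simp: binom_coef_def)
next
  case False
  then obtain n where "k = int (Suc n)"
    by (metis linorder_not_le pos_int_cases Suc_pred)
  then show ?thesis
    using gbinomial_Suc_Suc[of "of_int m :: rat" n]
    by (simp add: binom_coef_def nat_add_distrib algebra_simps)
qed

lemma binom_coef_minus_1: "0 \<le> k \<Longrightarrow> binom_coef (-1) k = 1"
proof (induction k rule: int_ge_induct)
  case (step k)
  then show ?case using binom_coef_succ[of "-1" "k + 1"] by (simp add: binom_coef_def nat_add_distrib gbinomial_0)
qed (simp add: binom_coef_def)

lemma binom_coef_minus_2: "0 \<le> k \<Longrightarrow> binom_coef (-2) k = of_int k + 1"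
proof (induction k rule: int_ge_induct)
  case (step k)
  then show ?case using binom_coef_succ[of "-2" "k + 1"] binom_coef_minus_1[of "k + 1"] by simp
qed (simp add: binom_coef_def)

text \<open>Supplies the leaf induction that a definition of trees by connectedness and edge count
  does not offer directly.\<close>

inductive grown_tree :: "('a \<Rightarrow> 'a \<Rightarrow> bool) \<Rightarrow> 'a set \<Rightarrow> bool" for Adj where
  single: "grown_tree Adj {v}"
| leaf: "grown_tree Adj S \<Longrightarrow> u \<notin> S \<Longrightarrow> w \<in> S \<Longrightarrow> Adj u w \<Longrightarrow>
    (\<And>x. x \<in> S \<Longrightarrow> Adj u x \<Longrightarrow> x = w) \<Longrightarrow> grown_tree Adj (insert u S)"

lemma grown_tree_finite: "grown_tree Adj S \<Longrightarrow> finite S \<and> S \<noteq> {}"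
  by (induction rule: grown_tree.induct) auto

text \<open>Leaf induction. A leaf \<open>u\<close> at \<open>w\<close> raises the valency of
  \<open>w\<close>, which multiplies the factor of \<open>w\<close> by \<open>1 - x\<close>. On the
  side of the maxima, eliminating \<open>u\<close> leaves the difference of the sums for
  \<open>g\<close> and for its translate by \<open>u\<close>, in which \<open>k w\<close> is one
  smaller. \<open>binom_coef_succ\<close> matches the two effects.\<close>

lemma alt_max_grown_tree:
  assumes "grown_tree Adj S"
    and sym: "\<And>v w. Adj v w \<Longrightarrow> Adj w v" and irr: "\<And>v. \<not> Adj v v"
    and "\<And>v K. v \<in> S \<Longrightarrow> K \<subseteq> S - {v} \<Longrightarrow>
           g (insert v K) = g K + of_int (k v + 1 - int (card {w \<in> K. Adj v w}))"
  shows "alt_max g S = (\<Prod>v\<in>S. binom_coef (int (valency S Adj v) - 2) (k v))"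
  using assms(1,4)
proof (induction arbitrary: g k rule: grown_tree.induct)
  case (single v)
  have g: "g {v} = g {} + of_int (k v + 1)" using single[of v "{}"] by simp
  have val: "valency {v} Adj v = 0" using irr by (auto simp: valency_def)
  have "alt_max g {v} = - g {} + max (g {v}) (g {})"
    using alt_max_insert[of "{}" v g] by (simp add: Pow_insert max.commute)
  also have "\<dots> = binom_coef (-2) (k v)"
    using g by (cases "k v < 0") (auto simp: binom_coef_minus_2 max_def)
  finally show ?case by (simp add: val)
next
  case (leaf S u w)
  have fin: "finite S" "S \<noteq> {}" using grown_tree_finite[OF leaf.hyps(1)] by auto
  have nb: "{x \<in> K. Adj u x} = (if w \<in> K then {w} else {})" if "K \<subseteq> S" for K
    using that leaf.hyps(3,4) by (auto dest: leaf.hyps(5))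
  have gu: "g (insert u K) = g K + of_int (k u + 1 - (if w \<in> K then 1 else 0))" if "K \<subseteq> S" for K
  proof -
    have "g (insert u K) = g K + of_int (k u + 1 - int (card {x \<in> K. Adj u x}))"
      using leaf.prems[of u K] leaf.hyps(2) that by auto
    then show ?thesis unfolding nb[OF that] by simp
  qed
  have val_u: "valency (insert u S) Adj u = 1"
  proof -
    have "{x \<in> insert u S. Adj u x} = {w}" using nb[of S] irr leaf.hyps(3) by auto
    then show ?thesis by (simp add: valency_def)
  qed
  have val_w: "valency (insert u S) Adj w = Suc (valency S Adj w)"
  proof -
    have "{x \<in> insert u S. Adj w x} = insert u {x \<in> S. Adj w x}" using sym leaf.hyps(4) by blast
    then show ?thesis using fin leaf.hyps(2,3) by (simp add: valency_def)
  qed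
  have val: "valency (insert u S) Adj x = valency S Adj x" if "x \<in> S" "x \<noteq> w" for x
  proof -
    have "{z \<in> insert u S. Adj x z} = {z \<in> S. Adj x z}" using sym leaf.hyps(5) that by blast
    then show ?thesis by (simp add: valency_def)
  qed
  show ?case
  \<comment> \<open>The increment in direction \<open>u\<close> is \<open>k u + 1\<close> if
    \<open>w\<close> is absent and \<open>k u\<close> if it is present. As \<open>k u\<close> is an
    integer, both are at most 0 if \<open>k u < 0\<close>, and both are at least 0
    otherwise.\<close>
  proof (cases "k u < 0")
    case True
    have "alt_max g (insert u S) = 0"
    proof (rule alt_max_eq_0[of _ u])
      fix K assume "K \<subseteq> insert u S - {u}"
      then have "K \<subseteq> S" by auto
      then show "g (insert u K) \<le> g K" using gu[of K] True by auto
    qed (use fin in auto)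
    moreover have "(\<Prod>v\<in>insert u S. binom_coef (int (valency (insert u S) Adj v) - 2) (k v)) = 0"
      using True fin by (intro prod_zero) auto
    ultimately show ?thesis by simp
  next
    case False
    \<comment> \<open>On the face containing \<open>u\<close>, the vertex \<open>w\<close> has one
      more neighbour present, which lowers its increment and hence \<open>k w\<close> by
      one.\<close>
    define g' where "g' K = g (insert u K)" for K
    define k' where "k' = k(w := k w - 1)"
    define P where "P = (\<Prod>v\<in>S - {w}. binom_coef (int (valency S Adj v) - 2) (k v))"
    have prem: "g (insert v K) = g K + of_int (k v + 1 - int (card {x \<in> K. Adj v x}))"
      if "v \<in> S" "K \<subseteq> S - {v}" for v K
      using leaf.prems[of v K] that leaf.hyps(2) by auto
    have prem': "g' (insert v K) = g' K + of_int (k' v + 1 - int (card {x \<in> K. Adj v x}))"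
      if "v \<in> S" "K \<subseteq> S - {v}" for v K
    proof -
      have "{x \<in> insert u K. Adj v x} = (if v = w then insert u {x \<in> K. Adj v x} else {x \<in> K. Adj v x})"
        using leaf.hyps(4) sym that by (auto dest: leaf.hyps(5))
      moreover have "finite K" "u \<notin> K" using that fin leaf.hyps(2) finite_subset by auto
      ultimately have "card {x \<in> insert u K. Adj v x} = (if v = w then 1 else 0) + card {x \<in> K. Adj v x}"
        by auto
      moreover have "g' (insert v K) = g (insert u K) +
          of_int (k v + 1 - int (card {x \<in> insert u K. Adj v x}))"
        using leaf.prems[of v "insert u K"] that leaf.hyps(2) by (auto simp: g'_def insert_commute)
      ultimately show ?thesis by (auto simp: g'_def k'_def)
    qed
    have "alt_max g (insert u S) =
      (\<Sum>J\<in>Pow S. (-1) ^ (card J + 1) * (Max (g ` Pow J) - Max (g' ` Pow J)))"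
      unfolding alt_max_insert[OF fin(1) leaf.hyps(2)] g'_def
    proof (intro sum.cong refl)
      fix J assume "J \<in> Pow S"
      then have "J \<subseteq> S" "finite J" using fin finite_subset by auto
      then have "Max (g ` Pow (insert u J)) = Max ((\<lambda>K. g (insert u K)) ` Pow J)"
        using gu False by (intro Max_Pow_insert_increasing) auto
      then show "(-1) ^ (card J + 1) * (Max (g ` Pow J) - Max (g ` Pow (insert u J))) =
        (-1) ^ (card J + 1) * (Max (g ` Pow J) - Max ((\<lambda>K. g (insert u K)) ` Pow J))" by simp
    qed
    also have "\<dots> = alt_max g S - alt_max g' S"
      by (simp only: alt_max_def right_diff_distrib sum_subtractf)
    also have "alt_max g S = binom_coef (int (valency S Adj w) - 2) (k w) * P"
      unfolding P_def using leaf.IH[of g k] prem fin leaf.hyps(3) by (simp add: prod.remove)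
    also have "alt_max g' S = binom_coef (int (valency S Adj w) - 2) (k w - 1) * P"
    proof -
      have "(\<Prod>v\<in>S - {w}. binom_coef (int (valency S Adj v) - 2) (k' v)) = P"
        unfolding P_def by (intro prod.cong) (auto simp: k'_def)
      then show ?thesis
        using leaf.IH[of g' k'] prem' fin leaf.hyps(3) by (simp add: prod.remove k'_def)
    qed
    also have "binom_coef (int (valency S Adj w) - 2) (k w) * P -
        binom_coef (int (valency S Adj w) - 2) (k w - 1) * P =
        binom_coef (int (valency S Adj w) - 1) (k w) * P"
      using binom_coef_succ[of "int (valency S Adj w) - 2" "k w"] by (simp flip: left_diff_distrib)
    also have "\<dots> = (\<Prod>v\<in>insert u S. binom_coef (int (valency (insert u S) Adj v) - 2) (k v))"
    proof -
      have "P = (\<Prod>v\<in>S - {w}. binom_coef (int (valency (insert u S) Adj v) - 2) (k v))"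
        unfolding P_def by (intro prod.cong) (auto simp: val)
      then show ?thesis
        using fin leaf.hyps(2,3) False
        by (simp add: val_u val_w binom_coef_minus_1 prod.remove[of S w])
    qed
    finally show ?thesis .
  qed
qed

subsection \<open>Cube sums over boxes\<close>

definition shift :: "('a \<Rightarrow> int) \<Rightarrow> 'a set \<Rightarrow> 'a \<Rightarrow> int" where
  "shift y J = (\<lambda>v. y v + of_bool (v \<in> J))"

definition cubes :: "('a \<Rightarrow> int) \<Rightarrow> ('a \<Rightarrow> int) \<Rightarrow> (('a \<Rightarrow> int) \<times> 'a set) set" where
  "cubes l u = {(y, J). l \<le> y \<and> shift y J \<le> u}"

definition cube_max :: "(('a \<Rightarrow> int) \<Rightarrow> rat) \<Rightarrow> ('a \<Rightarrow> int) \<Rightarrow> 'a set \<Rightarrow> rat" where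
  "cube_max W y J = Max ((\<lambda>K. W (shift y K)) ` Pow J)"

text \<open>Minus a weighted Euler characteristic of the box: the cell \<open>(y, J)\<close> has
  dimension \<open>card J\<close> and carries the largest value of \<open>W\<close> at its
  vertices.\<close>

definition cube_sum :: "(('a \<Rightarrow> int) \<Rightarrow> rat) \<Rightarrow> ('a \<Rightarrow> int) \<Rightarrow> ('a \<Rightarrow> int) \<Rightarrow> rat" where
  "cube_sum W l u = (\<Sum>(y, J)\<in>cubes l u. (-1) ^ (card J + 1) * cube_max W y J)"

lemma shift_empty [simp]: "shift y {} = y"
  by (simp add: shift_def)

lemma shift_insert: "v \<notin> K \<Longrightarrow> shift y (insert v K) = (shift y K)(v := shift y K v + 1)"
  by (auto simp: shift_def)

lemma le_shift: "y \<le> shift y K"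
  by (simp add: shift_def le_fun_def)

lemma shift_mono: "K \<subseteq> J \<Longrightarrow> shift y K \<le> shift y J"
  by (auto simp: shift_def le_fun_def)

lemma finite_box:
  fixes l u :: "'a \<Rightarrow> int"
  assumes "finite T" "\<And>v. v \<notin> T \<Longrightarrow> l v = u v"
  shows "finite {l..u}"
proof (rule finite_subset)
  show "{l..u} \<subseteq> (\<lambda>f v. if v \<in> T then f v else l v) ` (PiE T (\<lambda>v. {l v..u v}))"
  proof
    fix y assume y: "y \<in> {l..u}"
    have "y v = l v" if "v \<notin> T" for v
      using y assms(2)[OF that] by (simp add: le_fun_def) (metis antisym)
    then have "y = (\<lambda>v. if v \<in> T then restrict y T v else l v)"
      by auto
    moreover have "restrict y T \<in> PiE T (\<lambda>v. {l v..u v})"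
      using y by (auto simp: le_fun_def)
    ultimately show "y \<in> (\<lambda>f v. if v \<in> T then f v else l v) ` (PiE T (\<lambda>v. {l v..u v}))"
      by blast
  qed
  show "finite ((\<lambda>f v. if v \<in> T then f v else l v) ` (PiE T (\<lambda>v. {l v..u v})))"
    using assms(1) by (intro finite_imageI finite_PiE) auto
qed

lemma cubes_subset:
  assumes "\<And>v. v \<notin> T \<Longrightarrow> l v = u v"
  shows "cubes l u \<subseteq> {l..u} \<times> Pow T"
proof clarify
  fix y J assume "(y, J) \<in> cubes l u"
  then have yJ: "l \<le> y" "shift y J \<le> u" by (auto simp: cubes_def)
  have "v \<in> T" if "v \<in> J" for v
    using yJ(1)[THEN le_funD, of v] yJ(2)[THEN le_funD, of v] assms[of v] that by (auto simp: shift_def)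
  then show "y \<in> {l..u} \<and> J \<in> Pow T"
    using yJ le_shift[of y J] by auto
qed

lemma finite_cubes:
  assumes "finite T" "\<And>v. v \<notin> T \<Longrightarrow> l v = u v"
  shows "finite (cubes l u)"
  using cubes_subset[of T l u, OF assms(2)] finite_box[of T l u, OF assms] assms(1)
  by (meson finite_Pow_iff finite_SigmaI finite_subset)

lemma shift_in_box: "(y, J) \<in> cubes l u \<Longrightarrow> K \<subseteq> J \<Longrightarrow> shift y K \<in> {l..u}"
  using le_shift[of y K] shift_mono[of K J y] by (fastforce simp: cubes_def)

lemma cube_sum_cong:
  assumes "\<And>y. y \<in> {l..u} \<Longrightarrow> W y = W' y"
  shows "cube_sum W l u = cube_sum W' l u"
  unfolding cube_sum_def
proof (intro sum.cong refl, clarify)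
  fix y J assume "(y, J) \<in> cubes l u"
  then have "(\<lambda>K. W (shift y K)) ` Pow J = (\<lambda>K. W' (shift y K)) ` Pow J"
    by (intro image_cong refl assms) (use shift_in_box in blast)
  then show "(-1) ^ (card J + 1) * cube_max W y J = (-1) ^ (card J + 1) * cube_max W' y J"
    by (simp add: cube_max_def)
qed

lemma cube_sum_point: "cube_sum W l l = - W l"
proof -
  have "cubes l l = {(l, {})}"
  proof
    show "cubes l l \<subseteq> {(l, {})}" using cubes_subset[of "{}" l l] by auto
    show "{(l, {})} \<subseteq> cubes l l" by (auto simp: cubes_def)
  qed
  then show ?thesis by (simp add: cube_sum_def cube_max_def)
qed

text \<open>Two kinds of cells disappear: those inside the top face (\<open>P\<close>) and those of
  one dimension more that enter it from below (\<open>Q\<close>). They correspond bijectively. Since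
  \<open>W\<close> does not decrease along the last step, a cell of \<open>Q\<close> has its maximum
  on its top face, so partners cancel.\<close>

lemma cube_sum_remove_top_layer:
  assumes "finite T" "\<And>w. w \<notin> T \<Longrightarrow> l w = u w" and lu: "l v < u v"
    and mono: "\<And>y. y \<in> {l..u} \<Longrightarrow> y v = u v - 1 \<Longrightarrow> W y \<le> W (y(v := u v))"
  shows "cube_sum W l u = cube_sum W l (u(v := u v - 1))"
proof -
  let ?f = "\<lambda>(y, J). (-1) ^ (card J + 1) * cube_max W y J"
  define u' where "u' = u(v := u v - 1)"
  define P where "P = {(y, J) \<in> cubes l u. y v = u v}"
  define Q where "Q = {(y, J) \<in> cubes l u. y v = u v - 1 \<and> v \<in> J}"
  have fin: "finite (cubes l u)" by (rule finite_cubes) (use assms in auto)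
  have shift_u: "shift y J w \<le> u w" if "(y, J) \<in> cubes l u" for y J w
    using that by (auto simp: cubes_def le_fun_def)
  have nP: "v \<notin> J" if "(y, J) \<in> cubes l u" "y v = u v" for y J
    using shift_u[OF that(1), of v] that(2) by (auto simp: shift_def)
  have "cubes l u = cubes l u' \<union> (P \<union> Q)"
  proof (intro set_eqI, clarify)
    fix y J
    have "(y, J) \<in> cubes l u' \<longleftrightarrow> (y, J) \<in> cubes l u \<and> shift y J v \<le> u v - 1"
      by (force simp: cubes_def u'_def le_fun_def split: if_splits)
    moreover have "shift y J v \<le> u v - 1 \<or> y v = u v \<or> (y v = u v - 1 \<and> v \<in> J)"
      if "(y, J) \<in> cubes l u"
      using shift_u[OF that, of v] by (auto simp: shift_def split: if_splits)
    ultimately show "(y, J) \<in> cubes l u \<longleftrightarrow> (y, J) \<in> cubes l u' \<union> (P \<union> Q)"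
      by (auto simp: P_def Q_def)
  qed
  moreover have "cubes l u' \<inter> (P \<union> Q) = {}"
    by (auto simp: P_def Q_def cubes_def u'_def le_fun_def shift_def split: if_splits
        dest: spec[of _ v])
  moreover have "P \<inter> Q = {}" by (auto simp: P_def Q_def)
  moreover have "finite (cubes l u')" "finite P" "finite Q"
    using fin calculation(1) by (auto intro: finite_subset)
  ultimately have "cube_sum W l u = cube_sum W l u' + (sum ?f P + sum ?f Q)"
    unfolding cube_sum_def by (simp add: sum.union_disjoint)
  moreover have "sum ?f Q = (\<Sum>x\<in>P. - ?f x)"
  proof (rule sum.reindex_bij_witness[where
        i = "\<lambda>(y, J). (y(v := u v - 1), insert v J)" and j = "\<lambda>(y, J). (y(v := u v), J - {v})"])
    fix x assume "x \<in> Q"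
    then obtain y J where x: "x = (y, J)" "(y, J) \<in> cubes l u" "y v = u v - 1" "v \<in> J"
      by (auto simp: Q_def)
    have fJ: "finite J"
      using subsetD[OF cubes_subset[of T l u, OF assms(2)] x(2)] assms(1) finite_subset by auto
    have shift_eq: "shift (y(v := u v)) K = shift y (insert v K)" if "v \<notin> K" for K
      using that x(3) by (auto simp: shift_def)
    show "(case case x of (y, J) \<Rightarrow> (y(v := u v), J - {v}) of (y, J) \<Rightarrow> (y(v := u v - 1), insert v J)) = x"
      using x by (auto simp: fun_eq_iff)
    have "shift (y(v := u v)) (J - {v}) = shift y J"
      using x shift_eq[of "J - {v}"] by (simp add: insert_absorb)
    then show "(case x of (y, J) \<Rightarrow> (y(v := u v), J - {v})) \<in> P"
      using x lu by (auto simp: P_def cubes_def le_fun_def)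
    have "cube_max W y J = cube_max W y (insert v (J - {v}))"
      using x by (simp add: insert_absorb)
    also have "\<dots> = Max ((\<lambda>K. W (shift y (insert v K))) ` Pow (J - {v}))"
      unfolding cube_max_def
    proof (rule Max_Pow_insert_increasing)
      fix K assume K: "K \<subseteq> J - {v}"
      then have "shift y K \<in> {l..u}" using shift_in_box[OF x(2)] by blast
      moreover have "shift y K v = u v - 1" using K x by (auto simp: shift_def)
      ultimately have "W (shift y K) \<le> W ((shift y K)(v := u v))" by (rule mono)
      also have "(shift y K)(v := u v) = shift y (insert v K)"
        using K x(3) by (auto simp: shift_def)
      finally show "W (shift y K) \<le> W (shift y (insert v K))" .
    qed (use fJ in auto)
    also have "\<dots> = cube_max W (y(v := u v)) (J - {v})"
      unfolding cube_max_def
      by (intro arg_cong[of _ _ Max] image_cong refl) (metis Diff_iff PowD insertI1 shift_eq subsetD)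
    finally show "- ?f (case x of (y, J) \<Rightarrow> (y(v := u v), J - {v})) = ?f x"
      using card.remove[OF fJ x(4)] by (simp add: x(1))
  next
    fix x assume "x \<in> P"
    then obtain y J where x: "x = (y, J)" "(y, J) \<in> cubes l u" "y v = u v"
      by (auto simp: P_def)
    have nJ: "v \<notin> J" using nP x by auto
    show "(case case x of (y, J) \<Rightarrow> (y(v := u v - 1), insert v J) of (y, J) \<Rightarrow> (y(v := u v), J - {v})) = x"
      using x nJ by (auto simp: fun_eq_iff)
    have "shift (y(v := u v - 1)) (insert v J) = shift y J"
      using x nJ by (auto simp: shift_def)
    then show "(case x of (y, J) \<Rightarrow> (y(v := u v - 1), insert v J)) \<in> Q"
      using x lu by (auto simp: Q_def cubes_def le_fun_def)
  qed
  ultimately show ?thesis by (simp add: u'_def sum_negf)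
qed

text \<open>For a constant weight every top layer can be removed, so the box shrinks to the single
  point \<open>l\<close>.\<close>

lemma cube_sum_const:
  assumes "finite T" "\<And>w. w \<notin> T \<Longrightarrow> l w = u w" "l \<le> u"
  shows "cube_sum (\<lambda>_. c) l u = - c"
  using assms(2,3)
proof (induction "\<Sum>w\<in>T. nat (u w - l w)" arbitrary: u rule: less_induct)
  case less
  show ?case
  proof (cases "\<exists>v. l v < u v")
    case True
    then obtain v where v: "l v < u v" by auto
    then have vT: "v \<in> T" using less.prems(1)[of v] by auto
    let ?u = "u(v := u v - 1)"
    have "cube_sum (\<lambda>_. c) l u = cube_sum (\<lambda>_. c) l ?u"
      by (rule cube_sum_remove_top_layer[OF assms(1)]) (use less.prems v in auto)
    also have "\<dots> = - c"
    proof (rule less.hyps)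
      show "(\<Sum>w\<in>T. nat (?u w - l w)) < (\<Sum>w\<in>T. nat (u w - l w))"
        by (rule sum_strict_mono_ex1) (use assms(1) v vT in auto)
    qed (use less.prems v vT in \<open>auto simp: le_fun_def\<close>)
    finally show ?thesis .
  next
    case False
    then have "u = l" using less.prems(2) by (auto simp: le_fun_def fun_eq_iff intro: antisym simp: not_less)
    then show ?thesis by (simp add: cube_sum_point)
  qed
qed

text \<open>The alternating sum of the constant weight is an Euler characteristic of a box, which is why
  additive weights give additive cube sums.\<close>

lemma cube_sum_add:
  assumes fin: "finite A" "finite B" and disj: "A \<inter> B = {}" and c: "0 \<le> c"
    and WA: "\<And>y y'. (\<And>v. v \<in> A \<Longrightarrow> y v = y' v) \<Longrightarrow> WA y = WA y'"
    and WB: "\<And>y y'. (\<And>v. v \<in> B \<Longrightarrow> y v = y' v) \<Longrightarrow> WB y = WB y'"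
  defines "l \<equiv> \<lambda>S v. if v \<in> S then - c else (0::int)"
  shows "cube_sum (\<lambda>y. WA y + WB y) (l (A \<union> B)) (\<lambda>_. 0) = cube_sum WA (l A) (\<lambda>_. 0) + cube_sum WB (l B) (\<lambda>_. 0)"
proof -
  let ?f = "\<lambda>W (y, J). (-1) ^ (card J + 1) * cube_max W y J"
  let ?r = "\<lambda>S y v. if v \<in> S then y v else (0::int)"
  have sub: "J \<subseteq> S" "\<And>v. v \<notin> S \<Longrightarrow> y v = 0" if "(y, J) \<in> cubes (l S) (\<lambda>_. 0)" for y J S
  proof -
    have *: "cubes (l S) (\<lambda>_. 0) \<subseteq> {l S..\<lambda>_. 0} \<times> Pow S" by (rule cubes_subset) (simp add: l_def)
    then show "J \<subseteq> S" using that by auto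
    show "y v = 0" if "v \<notin> S" for v
    proof -
      have "l S \<le> y" "y \<le> (\<lambda>_. 0)" using * \<open>(y, J) \<in> cubes (l S) (\<lambda>_. 0)\<close> by auto
      then have "l S v \<le> y v" "y v \<le> 0" by (auto simp: le_fun_def)
      then show ?thesis using that by (simp add: l_def)
    qed
  qed
  \<comment> \<open>The cube is the product of its projections to \<open>A\<close> and
    \<open>B\<close>, and the two summands are maximized independently.\<close>
  have max_add: "cube_max (\<lambda>y. WA y + WB y) y J = cube_max WA (?r A y) (J \<inter> A) + cube_max WB (?r B y) (J \<inter> B)"
    if "J \<subseteq> A \<union> B" for y J
  proof -
    have fJ: "finite J" using that fin finite_subset by auto
    have a: "WA (shift y K) = WA (shift (?r A y) (K \<inter> A))" for K
      by (rule WA) (auto simp: shift_def)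
    have b: "WB (shift y K) = WB (shift (?r B y) (K \<inter> B))" for K
      by (rule WB) (auto simp: shift_def)
    show ?thesis unfolding cube_max_def
    proof (rule antisym)
      show "Max ((\<lambda>K. WA (shift y K) + WB (shift y K)) ` Pow J) \<le>
        Max ((\<lambda>K. WA (shift (?r A y) K)) ` Pow (J \<inter> A)) + Max ((\<lambda>K. WB (shift (?r B y) K)) ` Pow (J \<inter> B))"
      proof (rule Max.boundedI)
        fix x assume "x \<in> (\<lambda>K. WA (shift y K) + WB (shift y K)) ` Pow J"
        then obtain K where K: "K \<subseteq> J" "x = WA (shift y K) + WB (shift y K)" by auto
        show "x \<le> Max ((\<lambda>K. WA (shift (?r A y) K)) ` Pow (J \<inter> A)) + Max ((\<lambda>K. WB (shift (?r B y) K)) ` Pow (J \<inter> B))"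
          unfolding K(2) a[of K] b[of K] using K(1) fJ by (intro add_mono Max_ge) auto
      qed (use fJ in auto)
      have "Max ((\<lambda>K. WA (shift (?r A y) K)) ` Pow (J \<inter> A)) \<in> (\<lambda>K. WA (shift (?r A y) K)) ` Pow (J \<inter> A)"
        using fJ by (intro Max_in) auto
      then obtain K1 where K1: "K1 \<subseteq> J \<inter> A" "Max ((\<lambda>K. WA (shift (?r A y) K)) ` Pow (J \<inter> A)) = WA (shift (?r A y) K1)"
        by auto
      have "Max ((\<lambda>K. WB (shift (?r B y) K)) ` Pow (J \<inter> B)) \<in> (\<lambda>K. WB (shift (?r B y) K)) ` Pow (J \<inter> B)"
        using fJ by (intro Max_in) auto
      then obtain K2 where K2: "K2 \<subseteq> J \<inter> B" "Max ((\<lambda>K. WB (shift (?r B y) K)) ` Pow (J \<inter> B)) = WB (shift (?r B y) K2)"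
        by auto
      have "(K1 \<union> K2) \<inter> A = K1" "(K1 \<union> K2) \<inter> B = K2" using K1 K2 disj by auto
      then have "WA (shift (?r A y) K1) + WB (shift (?r B y) K2) = WA (shift y (K1 \<union> K2)) + WB (shift y (K1 \<union> K2))"
        by (simp add: a[of "K1 \<union> K2"] b[of "K1 \<union> K2"])
      also have "\<dots> \<le> Max ((\<lambda>K. WA (shift y K) + WB (shift y K)) ` Pow J)"
        using K1 K2 fJ by (intro Max_ge) auto
      finally show "Max ((\<lambda>K. WA (shift (?r A y) K)) ` Pow (J \<inter> A)) + Max ((\<lambda>K. WB (shift (?r B y) K)) ` Pow (J \<inter> B))
        \<le> Max ((\<lambda>K. WA (shift y K) + WB (shift y K)) ` Pow J)"
        unfolding K1(2) K2(2) .
    qed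
  qed
  have one: "(\<Sum>(y, J)\<in>cubes (l S) (\<lambda>_. 0). (-1) ^ card J) = (1::rat)" if "finite S" for S
  proof -
    have "cube_max (\<lambda>_. 1) y J = 1" for y :: "'a \<Rightarrow> int" and J
    proof -
      have "(\<lambda>K. 1::rat) ` Pow J = {1}" by auto
      then show ?thesis by (simp add: cube_max_def)
    qed
    then have "cube_sum (\<lambda>_. 1) (l S) (\<lambda>_. 0) = - (\<Sum>(y, J)\<in>cubes (l S) (\<lambda>_. 0). (-1) ^ card J)"
      by (simp add: cube_sum_def sum_negf[symmetric] split_def)
    moreover have "cube_sum (\<lambda>_. 1) (l S) (\<lambda>_. 0) = - 1"
      by (rule cube_sum_const[OF that]) (use c in \<open>auto simp: l_def le_fun_def\<close>)
    ultimately show ?thesis by simp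
  qed
  \<comment> \<open>Cells over \<open>A \<union> B\<close> are pairs of cells of the two factors.
    Dimensions add, so signs multiply, and in each summand the factor without weight sums to
    1.\<close>
  define split :: "('a \<Rightarrow> int) \<times> 'a set \<Rightarrow> (('a \<Rightarrow> int) \<times> 'a set) \<times> (('a \<Rightarrow> int) \<times> 'a set)"
    where "split = (\<lambda>(y, J). ((?r A y, J \<inter> A), (?r B y, J \<inter> B)))"
  define glue :: "(('a \<Rightarrow> int) \<times> 'a set) \<times> (('a \<Rightarrow> int) \<times> 'a set) \<Rightarrow> ('a \<Rightarrow> int) \<times> 'a set"
    where "glue = (\<lambda>((y, J), (y', J')). (\<lambda>v. y v + y' v, J \<union> J'))"
  have "cube_sum (\<lambda>y. WA y + WB y) (l (A \<union> B)) (\<lambda>_. 0) =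
    (\<Sum>(p, q)\<in>cubes (l A) (\<lambda>_. 0) \<times> cubes (l B) (\<lambda>_. 0). ?f WA p * (case q of (y, J) \<Rightarrow> (-1) ^ card J)
        + (case p of (y, J) \<Rightarrow> (-1) ^ card J) * ?f WB q)"
    unfolding cube_sum_def
  proof (rule sum.reindex_bij_witness[where j = split and i = glue])
    fix x assume "x \<in> cubes (l (A \<union> B)) (\<lambda>_. 0)"
    then obtain y J where x: "x = (y, J)" "(y, J) \<in> cubes (l (A \<union> B)) (\<lambda>_. 0)" by (cases x) auto
    have J: "J \<subseteq> A \<union> B" and y0: "\<And>v. v \<notin> A \<union> B \<Longrightarrow> y v = 0" using sub[OF x(2)] by auto
    have "(\<lambda>v. ?r A y v + ?r B y v) = y" "J \<inter> A \<union> J \<inter> B = J"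
      using J y0 disj by (force simp: fun_eq_iff)+
    then show "glue (split x) = x"
      by (simp add: x(1) glue_def split_def)
    have le: "l (A \<union> B) v \<le> y v" "shift y J v \<le> 0" for v
      using x(2) by (auto simp: cubes_def le_fun_def)
    have "l A v \<le> ?r A y v" "l B v \<le> ?r B y v" for v
      using le(1)[of v] by (auto simp: l_def)
    then have "?r A y \<ge> l A" "?r B y \<ge> l B"
      by (auto simp: le_fun_def)
    moreover have "shift (?r A y) (J \<inter> A) v \<le> 0" "shift (?r B y) (J \<inter> B) v \<le> 0" for v
      using le(2)[of v] by (auto simp: shift_def)
    then have "shift (?r A y) (J \<inter> A) \<le> (\<lambda>_. 0)" "shift (?r B y) (J \<inter> B) \<le> (\<lambda>_. 0)"
      by (auto simp: le_fun_def)
    ultimately show "split x \<in> cubes (l A) (\<lambda>_. 0) \<times> cubes (l B) (\<lambda>_. 0)"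
      by (simp add: cubes_def x(1) split_def)
    have "card J = card (J \<inter> A) + card (J \<inter> B)"
      using J disj fin by (subst card_Un_disjoint[symmetric]) (auto intro: arg_cong[of _ _ card])
    then show "(case split x of (p, q) \<Rightarrow>
        ?f WA p * (case q of (y, J) \<Rightarrow> (-1) ^ card J) + (case p of (y, J) \<Rightarrow> (-1) ^ card J) * ?f WB q) =
        ?f (\<lambda>y. WA y + WB y) x"
      using max_add[OF J, of y] by (simp add: x(1) split_def power_add algebra_simps)
  next
    fix x assume "x \<in> cubes (l A) (\<lambda>_. 0) \<times> cubes (l B) (\<lambda>_. 0)"
    then obtain y J y' J' where x: "x = ((y, J), (y', J'))" "(y, J) \<in> cubes (l A) (\<lambda>_. 0)" "(y', J') \<in> cubes (l B) (\<lambda>_. 0)"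
      by (cases x) auto
    note s = sub[OF x(2)] sub[OF x(3)]
    have le: "l A v \<le> y v" "shift y J v \<le> 0" "l B v \<le> y' v" "shift y' J' v \<le> 0" for v
      using x(2,3) by (auto simp: cubes_def le_fun_def)
    have y0: "y v = 0" if "v \<in> B" for v using that s(2) disj by auto
    have y0': "y' v = 0" if "v \<in> A" for v using that s(4) disj by auto
    have "?r A (\<lambda>v. y v + y' v) = y" "?r B (\<lambda>v. y v + y' v) = y'"
      using s(2,4) y0 y0' by fastforce+
    moreover have "(J \<union> J') \<inter> A = J" "(J \<union> J') \<inter> B = J'" using s(1,3) disj by auto
    ultimately show "split (glue x) = x"
      by (simp add: x(1) split_def glue_def)
    have "l (A \<union> B) v \<le> y v + y' v" for v
      using le(1,3)[of v] s(2,4)[of v] y0 y0' by (auto simp: l_def split: if_splits)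
    moreover have "shift (\<lambda>v. y v + y' v) (J \<union> J') v \<le> 0" for v
      using le(2)[of v] le(4)[of v] s y0 y0' disj
      by (cases "v \<in> A"; cases "v \<in> B") (auto simp: shift_def)
    ultimately show "glue x \<in> cubes (l (A \<union> B)) (\<lambda>_. 0)"
      by (simp add: cubes_def le_fun_def x(1) glue_def)
  qed
  also have "\<dots> = cube_sum WA (l A) (\<lambda>_. 0) * (\<Sum>(y, J)\<in>cubes (l B) (\<lambda>_. 0). (-1) ^ card J)
      + (\<Sum>(y, J)\<in>cubes (l A) (\<lambda>_. 0). (-1) ^ card J) * cube_sum WB (l B) (\<lambda>_. 0)"
    unfolding cube_sum_def sum_product
    by (simp only: sum.cartesian_product[symmetric] sum.distrib)
  finally show ?thesis using one[OF fin(1)] one[OF fin(2)] by simp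
qed

subsection \<open>Subtrees and components\<close>

lemma finite_edges: "finite S \<Longrightarrow> finite (edges S Adj)"
  by (rule finite_subset[of _ "Pow S"]) (auto simp: edges_def)

lemma edges_subset: "U \<subseteq> S \<Longrightarrow> edges U Adj \<subseteq> edges S Adj"
  by (auto simp: edges_def)

lemma reach_exit:
  assumes "reach S Adj x y" "x \<in> U" "y \<notin> U"
  shows "\<exists>v\<in>U. \<exists>w\<in>S - U. Adj v w"
  using assms unfolding reach_def by (induction rule: rtranclp_induct) auto

lemma card_edges_insert:
  assumes "finite U" "w \<notin> U" "N \<subseteq> {v \<in> U. Adj v w}"
  shows "card (edges U Adj) + card N \<le> card (edges (insert w U) Adj)"
proof -
  have fN: "finite N" using assms finite_subset by fastforce
  have "card ((\<lambda>v. {v, w}) ` N) = card N"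
    using assms by (intro card_image) (auto simp: inj_on_def doubleton_eq_iff)
  then have "card (edges U Adj) + card N = card (edges U Adj \<union> (\<lambda>v. {v, w}) ` N)"
    using assms finite_edges[OF assms(1), of Adj] fN
    by (subst card_Un_disjoint) (auto simp: edges_def doubleton_eq_iff)
  also have "\<dots> \<le> card (edges (insert w U) Adj)"
  proof (rule card_mono)
    show "edges U Adj \<union> (\<lambda>v. {v, w}) ` N \<subseteq> edges (insert w U) Adj"
      using edges_subset[of U "insert w U" Adj] assms(3) unfolding edges_def by blast
  qed (use assms(1) in \<open>simp add: finite_edges\<close>)
  finally show ?thesis .
qed

text \<open>By connectedness an edge leaves every nonempty proper subset \<open>U\<close>. Adding
  its far end gains one vertex and at least one edge; this is repeated until \<open>S\<close> is
  exhausted.\<close>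

lemma card_edges_connected:
  assumes "finite S" and conn: "\<And>v w. v \<in> S \<Longrightarrow> w \<in> S \<Longrightarrow> reach S Adj v w"
    and "U \<subseteq> S" "U \<noteq> {}"
  shows "card (edges U Adj) + card (S - U) \<le> card (edges S Adj)"
  using assms(3,4)
proof (induction "card (S - U)" arbitrary: U)
  case 0
  then have "U = S" using assms(1) by auto
  then show ?case by simp
next
  case (Suc n)
  from Suc.hyps(2) have "S - U \<noteq> {}" by (metis card.empty nat.distinct(1))
  then obtain x y where "x \<in> U" "y \<in> S - U" using Suc.prems by auto
  then obtain v w where vw: "v \<in> U" "w \<in> S - U" "Adj v w"
    using reach_exit[OF conn, of x y U] Suc.prems by auto
  have fU: "finite U" using Suc.prems assms(1) finite_subset by auto
  have n: "card (S - U) = Suc (card (S - insert w U))"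
    using vw assms(1) by (metis Diff_insert card.remove finite_Diff)
  then have "card (edges (insert w U) Adj) + card (S - insert w U) \<le> card (edges S Adj)"
    using Suc.hyps Suc.prems vw by (intro Suc.hyps(1)) auto
  moreover have "card (edges U Adj) + 1 \<le> card (edges (insert w U) Adj)"
    using card_edges_insert[OF fU, of w "{v}" Adj] vw by auto
  ultimately show ?case using n by linarith
qed

lemma grown_tree_card_edges:
  assumes "grown_tree Adj S" and sym: "\<And>v w. Adj v w \<Longrightarrow> Adj w v"
  shows "card S \<le> card (edges S Adj) + 1"
  using assms(1)
proof (induction rule: grown_tree.induct)
  case (leaf S u w)
  have "finite S" using grown_tree_finite[OF leaf.hyps(1)] by simp
  then show ?case
    using card_edges_insert[of S u "{w}" Adj] leaf.hyps(2-4) leaf.IH sym by auto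
qed simp

text \<open>\<open>C\<close> is grown along edges that leave the part already built. A new vertex
  with two neighbours in that part would close a cycle, which the edge count of the ambient tree
  excludes.\<close>

lemma connected_subset_of_tree:
  assumes tree: "is_tree V Adj" and C: "C \<subseteq> V" "C \<noteq> {}"
    and conn: "\<And>v w. v \<in> C \<Longrightarrow> w \<in> C \<Longrightarrow> reach C Adj v w"
  shows "grown_tree Adj C"
proof -
  have V: "finite V" "\<And>v w. v \<in> V \<Longrightarrow> w \<in> V \<Longrightarrow> reach V Adj v w" "card (edges V Adj) + 1 = card V"
    and sym: "\<And>v w. Adj v w \<Longrightarrow> Adj w v"
    using tree by (auto simp: is_tree_def)
  have fC: "finite C" using C(1) V(1) by (rule finite_subset)
  \<comment> \<open>Completing \<open>U\<close> to \<open>V\<close> takes at least one edge per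
    missing vertex, while \<open>V\<close> has only \<open>card V - 1\<close> edges.\<close>
  have few: "card (edges U Adj) + 1 \<le> card U" if "U \<subseteq> V" "U \<noteq> {}" for U
  proof -
    have "card V = card U + card (V - U)"
      using that(1) V(1) by (metis card_Un_disjoint Diff_disjoint Diff_partition finite_Diff finite_subset)
    then show ?thesis using card_edges_connected[OF V(1,2) that] V(3) by simp
  qed
  have "\<exists>U\<subseteq>C. grown_tree Adj U \<and> card U = Suc n" if "n < card C" for n
    using that
  proof (induction n)
    case 0
    obtain v where "v \<in> C" using C by auto
    then show ?case using grown_tree.single[of Adj v] by (intro exI[of _ "{v}"]) auto
  next
    case (Suc n)
    then obtain U where U: "U \<subseteq> C" "grown_tree Adj U" "card U = Suc n" by auto
    have fU: "finite U" "U \<noteq> {}" using grown_tree_finite[OF U(2)] by auto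
    have "U \<noteq> C" using U Suc.prems by auto
    then obtain x y where "x \<in> U" "y \<in> C - U" using U fU by auto
    then obtain v w where vw: "v \<in> U" "w \<in> C - U" "Adj v w"
      using reach_exit[OF conn, of x y U] U by auto
    \<comment> \<open>Two neighbours in \<open>U\<close> would make \<open>insert w U\<close> span
      at least as many edges as it has vertices.\<close>
    have uniq: "x = v" if "x \<in> U" "Adj w x" for x
    proof (rule ccontr)
      assume "x \<noteq> v"
      then have "card (edges U Adj) + 2 \<le> card (edges (insert w U) Adj)"
        using card_edges_insert[OF fU(1), of w "{x, v}" Adj] vw that sym by auto
      moreover have "card (edges (insert w U) Adj) + 1 \<le> card (insert w U)"
        using U C vw by (intro few) auto
      moreover have "card U \<le> card (edges U Adj) + 1"
        using grown_tree_card_edges[OF U(2)] sym by auto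
      moreover have "card (insert w U) = card U + 1" using fU vw by simp
      ultimately show False by linarith
    qed
    have "grown_tree Adj (insert w U)"
      by (rule grown_tree.leaf[OF U(2) _ vw(1) sym[OF vw(3)] uniq]) (use vw(2) in auto)
    moreover have "card (insert w U) = Suc (Suc n)" "insert w U \<subseteq> C" using U(1,3) fU(1) vw(2) by auto
    ultimately show ?case by blast
  qed
  moreover have "card C \<noteq> 0" using fC C(2) by simp
  ultimately obtain U where "U \<subseteq> C" "grown_tree Adj U" "card U = card C"
    by (metis Suc_pred' diff_less neq0_conv zero_less_one)
  then show ?thesis using card_subset_eq[OF fC] by auto
qed

lemma reach_sym:
  assumes sym: "\<And>v w. Adj v w \<Longrightarrow> Adj w v" and "reach S Adj v w"
  shows "reach S Adj w v"
  using assms(2) unfolding reach_def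
proof (induction rule: rtranclp_induct)
  case (step y z)
  then show ?case using sym by (intro converse_rtranclp_into_rtranclp[of _ z y]) auto
qed simp

text \<open>A component is closed under adjacency in \<open>S\<close>, so a path in \<open>S\<close>
  from its root never leaves it; this turns reachability in \<open>S\<close> into reachability in
  \<open>C\<close>.\<close>

lemma components_facts:
  assumes sym: "\<And>v w. Adj v w \<Longrightarrow> Adj w v" and C: "C \<in> components S Adj"
  shows components_subset: "C \<subseteq> S"
    and components_nonempty: "C \<noteq> {}"
    and components_connected: "v \<in> C \<Longrightarrow> w \<in> C \<Longrightarrow> reach C Adj v w"
    and components_closed: "v \<in> C \<Longrightarrow> w \<in> S \<Longrightarrow> Adj v w \<Longrightarrow> w \<in> C"
proof -
  obtain x where x: "x \<in> S" "C = {w \<in> S. reach S Adj x w}" using C by (auto simp: components_def)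
  show "C \<subseteq> S" using x by auto
  have xC: "x \<in> C" using x by (auto simp: reach_def)
  then show "C \<noteq> {}" by auto
  show closed: "w \<in> C" if "v \<in> C" "w \<in> S" "Adj v w" for v w
  proof -
    have "reach S Adj x w"
      using that x rtranclp.rtrancl_into_rtrancl[of "\<lambda>a b. a \<in> S \<and> b \<in> S \<and> Adj a b" x v w]
      by (auto simp: reach_def)
    then show ?thesis using x that by auto
  qed
  have from_x: "reach C Adj x w" if "w \<in> C" for w
  proof -
    have "reach S Adj x w" using that x by auto
    then have "reach C Adj x w \<and> w \<in> C"
      unfolding reach_def
    proof (induction rule: rtranclp_induct)
      case base
      then show ?case using xC by auto
    next
      case (step y z)
      then have "z \<in> C" using closed by blast
      then show ?case using step by (auto intro: rtranclp.rtrancl_into_rtrancl)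
    qed
    then show ?thesis by simp
  qed
  show "reach C Adj v w" if "v \<in> C" "w \<in> C"
    using reach_sym[OF sym from_x[OF that(1)]] from_x[OF that(2)]
    unfolding reach_def by (rule rtranclp_trans)
qed

text \<open>From a common vertex, a path in one component that left the other would contradict the
  closedness of the latter.\<close>

lemma components_disjoint:
  assumes sym: "\<And>v w. Adj v w \<Longrightarrow> Adj w v"
    and "C \<in> components S Adj" "D \<in> components S Adj" "C \<noteq> D"
  shows "C \<inter> D = {}"
proof (rule ccontr)
  assume "C \<inter> D \<noteq> {}"
  then obtain x where x: "x \<in> C" "x \<in> D" by auto
  have sub: "X \<subseteq> Y" if X: "X \<in> components S Adj" "x \<in> X" and Y: "Y \<in> components S Adj" "x \<in> Y" for X Y
  proof
    fix w assume w: "w \<in> X"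
    show "w \<in> Y"
    proof (rule ccontr)
      assume "w \<notin> Y"
      then obtain v z where vz: "v \<in> Y" "z \<in> X - Y" "Adj v z"
        using reach_exit[OF components_connected[OF sym X(1,2) w], of Y] Y by auto
      then show False
        using components_closed[OF sym Y(1), of v z] components_subset[OF sym X(1)] by auto
    qed
  qed
  show False using sub[of C D] sub[of D C] assms x by auto
qed

lemma Union_components: "\<Union> (components S Adj) = S"
proof
  show "\<Union> (components S Adj) \<subseteq> S" by (auto simp: components_def)
  show "S \<subseteq> \<Union> (components S Adj)"
  proof
    fix v assume "v \<in> S"
    then have "v \<in> {w \<in> S. reach S Adj v w}" by (auto simp: reach_def)
    then show "v \<in> \<Union> (components S Adj)" using \<open>v \<in> S\<close> by (auto simp: components_def)
  qed
qed

lemma finite_components: "finite S \<Longrightarrow> finite (components S Adj)"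
  by (rule finite_subset[of _ "Pow S"]) (auto simp: components_def)

subsection \<open>The intersection form and the dual basis\<close>

locale plumbing =
  fixes Adj :: "'a \<Rightarrow> 'a \<Rightarrow> bool" and e :: "'a \<Rightarrow> int"
  assumes sym: "Adj v w \<Longrightarrow> Adj w v" and irr: "\<not> Adj v v"
begin

text \<open>The pairing \<open>(x, E_v)\<close> on the subgraph \<open>S\<close>. It is polymorphic
  because lattice offsets are integer vectors while elements of \<open>L'\<close> are
  rational.\<close>

definition pairE :: "'a set \<Rightarrow> ('a \<Rightarrow> 'b) \<Rightarrow> 'a \<Rightarrow> 'b::comm_ring_1" where
  "pairE S x v = (\<Sum>u\<in>S. x u * of_int (imat Adj e u v))"

lemma imat_sym: "imat Adj e v w = imat Adj e w v"
  using sym by (auto simp: imat_def)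

lemma imat_nonneg: "v \<noteq> w \<Longrightarrow> 0 \<le> imat Adj e v w"
  by (auto simp: imat_def)

lemma ip_Ebas:
  assumes "finite S" "v \<in> S"
  shows "ip S Adj e x (Ebas v) = pairE S x v"
  unfolding ip_def pairE_def Ebas_def
  using assms by (intro sum.cong refl) (simp add: if_distrib[of "\<lambda>t. _ * t"] if_distrib[of "\<lambda>t. t * _"] sum.delta cong: if_cong)

lemma of_int_pairE: "of_int (pairE S y v) = pairE S (\<lambda>u. of_int (y u)) v"
  by (simp add: pairE_def)

lemma pairE_add: "pairE S (\<lambda>u. x u + y u) v = pairE S x v + pairE S y v"
  by (simp add: pairE_def distrib_right sum.distrib)

lemma pairE_diff: "pairE S (\<lambda>u. x u - y u) v = pairE S x v - pairE S y v"
  by (simp add: pairE_def left_diff_distrib sum_subtractf)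

lemma pairE_scale: "pairE S (\<lambda>u. c * x u) v = c * pairE S x v"
  by (simp add: pairE_def sum_distrib_left mult.assoc)

text \<open>Off-diagonal entries of the intersection matrix are nonnegative. The diagonal entry may
  be negative, hence the equality at \<open>v\<close>.\<close>

lemma pairE_mono:
  fixes x y :: "'a \<Rightarrow> 'b::linordered_idom"
  assumes "\<And>u. u \<in> S \<Longrightarrow> x u \<le> y u" "x v = y v"
  shows "pairE S x v \<le> pairE S y v"
  unfolding pairE_def
proof (intro sum_mono)
  fix u assume "u \<in> S"
  then show "x u * of_int (imat Adj e u v) \<le> y u * of_int (imat Adj e u v)"
    using assms imat_nonneg[of u v] by (cases "u = v") (auto intro: mult_right_mono)
qed

lemma pairE_insert:
  "finite S \<Longrightarrow> s \<notin> S \<Longrightarrow> pairE (insert s S) x v = x s * of_int (imat Adj e s v) + pairE S x v"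
  by (simp add: pairE_def)

lemma negdef_rat:
  fixes x :: "'a \<Rightarrow> rat"
  assumes "neg_definite S Adj e" "\<exists>v\<in>S. x v \<noteq> 0"
  shows "(\<Sum>v\<in>S. x v * pairE S x v) < 0"
proof -
  have "(\<Sum>v\<in>S. \<Sum>w\<in>S. of_rat (x v) * of_rat (x w) * of_int (imat Adj e v w)) < (0::real)"
    using assms unfolding neg_definite_def by (auto elim!: allE[of _ "\<lambda>v. of_rat (x v)"])
  also have "(\<Sum>v\<in>S. \<Sum>w\<in>S. of_rat (x v) * of_rat (x w) * of_int (imat Adj e v w)) =
      of_rat (\<Sum>v\<in>S. x v * pairE S x v)"
    by (simp add: pairE_def of_rat_sum of_rat_mult sum_distrib_left mult.assoc imat_sym)
  finally show ?thesis by simp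
qed

lemma negdef_subset:
  assumes "neg_definite V Adj e" "finite V" "C \<subseteq> V"
  shows "neg_definite C Adj e"
  unfolding neg_definite_def
proof (intro allI impI)
  fix x :: "'a \<Rightarrow> real" assume x: "\<exists>v\<in>C. x v \<noteq> 0"
  define x' where "x' v = (if v \<in> C then x v else 0)" for v
  have "(\<Sum>v\<in>C. \<Sum>w\<in>C. x v * x w * of_int (imat Adj e v w)) =
      (\<Sum>v\<in>C. \<Sum>w\<in>C. x' v * x' w * of_int (imat Adj e v w))"
    by (simp add: x'_def)
  also have "\<dots> = (\<Sum>v\<in>C. \<Sum>w\<in>V. x' v * x' w * of_int (imat Adj e v w))"
    using assms by (intro sum.cong sum.mono_neutral_left) (auto simp: x'_def)
  also have "\<dots> = (\<Sum>v\<in>V. \<Sum>w\<in>V. x' v * x' w * of_int (imat Adj e v w))"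
    using assms by (intro sum.mono_neutral_left) (auto simp: x'_def)
  also have "\<dots> < 0"
  proof -
    have "\<exists>v\<in>V. x' v \<noteq> 0" using x assms(3) by (auto simp: x'_def)
    then show ?thesis using assms(1) unfolding neg_definite_def by blast
  qed
  finally show "(\<Sum>v\<in>C. \<Sum>w\<in>C. x v * x w * of_int (imat Adj e v w)) < 0" .
qed

text \<open>Negative definiteness is tested on the negative part \<open>m\<close> of
  \<open>q\<close>. Where \<open>m\<close> is nonzero it agrees with \<open>q\<close>, and
  everywhere it is at most \<open>q\<close>, so \<open>pairE S m u \<le> pairE S q u \<le> 0\<close>
  there. A nonzero \<open>m\<close> would then have nonnegative self-intersection.\<close>

lemma maximum_principle:
  fixes q :: "'a \<Rightarrow> rat"
  assumes "neg_definite S Adj e" and q: "\<And>v. v \<in> S \<Longrightarrow> q v < 0 \<Longrightarrow> pairE S q v \<le> 0"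
    and "v \<in> S"
  shows "0 \<le> q v"
proof (rule ccontr)
  assume "\<not> 0 \<le> q v"
  define m where "m u = min (q u) 0" for u
  have "(\<Sum>u\<in>S. m u * pairE S m u) < 0"
    using assms \<open>\<not> 0 \<le> q v\<close> by (intro negdef_rat) (auto simp: m_def intro!: bexI[of _ v])
  moreover have "0 \<le> (\<Sum>u\<in>S. m u * pairE S m u)"
  proof (intro sum_nonneg)
    fix u assume u: "u \<in> S"
    show "0 \<le> m u * pairE S m u"
    proof (cases "q u < 0")
      case True
      then have "pairE S m u \<le> pairE S q u" by (intro pairE_mono) (auto simp: m_def)
      also have "\<dots> \<le> 0" using q u True by auto
      finally show ?thesis by (intro mult_nonpos_nonpos) (auto simp: m_def)
    qed (simp add: m_def)
  qed
  ultimately show False by simp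
qed

text \<open>Orthogonalization, one vertex at a time: a solution on \<open>S\<close> is corrected by
  a multiple of a vector orthogonal to \<open>S\<close>.\<close>

lemma pairE_solvable:
  fixes b :: "'a \<Rightarrow> rat"
  assumes "finite S" "neg_definite S Adj e"
  shows "\<exists>x. supp_in S x \<and> (\<forall>w\<in>S. pairE S x w = b w)"
  using assms
proof (induction S arbitrary: b rule: finite_induct)
  case empty
  then show ?case by (auto simp: supp_in_def)
next
  case (insert s S)
  have nd: "neg_definite S Adj e"
    by (rule negdef_subset[OF insert.prems]) (use insert.hyps in auto)
  obtain u where u: "supp_in S u" "\<forall>w\<in>S. pairE S u w = of_int (imat Adj e s w)"
    using insert.IH[OF nd, of "\<lambda>w. of_int (imat Adj e s w)"] by auto
  obtain x where x: "supp_in S x" "\<forall>w\<in>S. pairE S x w = b w"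
    using insert.IH[OF nd, of b] by auto
  have us: "u s = 0" "x s = 0" using u x insert.hyps by (auto simp: supp_in_def)
  \<comment> \<open>\<open>u\<close> is the orthogonal projection of \<open>E_s\<close> to the span
    of \<open>S\<close>. Hence \<open>z\<close> pairs to 0 with every vertex of \<open>S\<close>,
    and \<open>d\<close> below is the negative number \<open>(z, z)\<close>. Adding \<open>t\<close>
    times \<open>z\<close> repairs the equation at \<open>s\<close> and keeps the others.\<close>
  define z where "z w = Ebas s w - u w" for w
  have zs: "z s = 1" using us by (simp add: z_def Ebas_def)
  have pz: "pairE (insert s S) z w = of_int (imat Adj e s w) - pairE S u w" for w
  proof -
    have "pairE S (Ebas s) w = 0"
      using insert.hyps by (auto simp: pairE_def Ebas_def intro!: sum.neutral)
    then have "pairE S z w = - pairE S u w"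
      by (simp add: z_def[abs_def] pairE_diff)
    then show ?thesis
      using insert.hyps zs by (simp add: pairE_insert)
  qed
  define d where "d = pairE (insert s S) z s"
  have "(\<Sum>w\<in>insert s S. z w * pairE (insert s S) z w) < 0"
    using zs by (intro negdef_rat insert.prems) auto
  also have "(\<Sum>w\<in>insert s S. z w * pairE (insert s S) z w) = d"
    using insert.hyps zs u pz by (simp add: d_def)
  finally have d: "d \<noteq> 0" by simp
  define t where "t = (b s - pairE (insert s S) x s) / d"
  define X where "X w = x w + t * z w" for w
  have pX: "pairE (insert s S) X w = pairE (insert s S) x w + t * pairE (insert s S) z w" for w
    unfolding X_def[abs_def] pairE_add pairE_scale ..
  have "supp_in (insert s S) X" using u x by (auto simp: supp_in_def X_def z_def Ebas_def)
  moreover have "pairE (insert s S) X w = b w" if "w \<in> insert s S" for w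
  proof (cases "w = s")
    case True
    then show ?thesis using d by (simp add: pX t_def d_def[symmetric])
  next
    case False
    then have "w \<in> S" using that by auto
    then show ?thesis using u x us insert.hyps by (simp add: pX pz pairE_insert)
  qed
  ultimately show ?case by blast
qed

lemma pairE_unique:
  fixes x y :: "'a \<Rightarrow> rat"
  assumes "neg_definite S Adj e" "supp_in S x" "supp_in S y"
    and "\<And>w. w \<in> S \<Longrightarrow> pairE S x w = pairE S y w"
  shows "x = y"
proof
  fix v
  show "x v = y v"
  proof (cases "v \<in> S")
    case True
    have "0 \<le> x v - y v" "0 \<le> y v - x v"
      by (rule maximum_principle[OF assms(1) _ True]; simp add: pairE_diff assms(4))+
    then show ?thesis by simp
  qed (use assms(2,3) in \<open>simp add: supp_in_def\<close>)
qed

text \<open>Existence and uniqueness of the solution make the definite description in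
  \<open>Estar\<close> meaningful.\<close>

lemma Estar_facts:
  assumes "finite S" "neg_definite S Adj e"
  shows supp_in_Estar: "supp_in S (Estar S Adj e v)"
    and pairE_Estar: "w \<in> S \<Longrightarrow> pairE S (Estar S Adj e v) w = (if v = w then -1 else 0)"
proof -
  have "\<exists>!x. supp_in S x \<and> (\<forall>w\<in>S. ip S Adj e x (Ebas w) = (if v = w then -1 else 0))"
  proof -
    obtain x where x: "supp_in S x" "\<forall>w\<in>S. pairE S x w = (if v = w then -1 else 0)"
      using pairE_solvable[OF assms, of "\<lambda>w. if v = w then -1 else 0"] by auto
    show ?thesis
    proof (rule ex1I[of _ x])
      show "supp_in S x \<and> (\<forall>w\<in>S. ip S Adj e x (Ebas w) = (if v = w then -1 else 0))"
        using x assms by (simp add: ip_Ebas)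
      fix y assume y: "supp_in S y \<and> (\<forall>w\<in>S. ip S Adj e y (Ebas w) = (if v = w then -1 else 0))"
      show "y = x"
        using x y assms(1) by (intro pairE_unique[OF assms(2)]) (auto simp: ip_Ebas)
    qed
  qed
  from theI'[OF this] have *: "supp_in S (Estar S Adj e v) \<and>
    (\<forall>w\<in>S. ip S Adj e (Estar S Adj e v) (Ebas w) = (if v = w then -1 else 0))"
    unfolding Estar_def .
  then show "supp_in S (Estar S Adj e v)" by simp
  show "pairE S (Estar S Adj e v) w = (if v = w then -1 else 0)" if "w \<in> S"
    using * that assms(1) by (simp add: ip_Ebas)
qed

lemma pairE_Estar_sum:
  assumes "finite S" "neg_definite S Adj e" "w \<in> S"
  shows "pairE S (\<lambda>u. \<Sum>v\<in>S. k v * Estar S Adj e v u) w = - k w"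
proof -
  have "pairE S (\<lambda>u. \<Sum>v\<in>S. k v * Estar S Adj e v u) w =
      (\<Sum>u\<in>S. \<Sum>v\<in>S. k v * (Estar S Adj e v u * of_int (imat Adj e u w)))"
    by (simp add: pairE_def sum_distrib_right mult.assoc)
  also have "\<dots> = (\<Sum>v\<in>S. k v * pairE S (Estar S Adj e v) w)"
    by (subst sum.swap) (simp add: pairE_def sum_distrib_left)
  also have "\<dots> = (\<Sum>v\<in>S. if v = w then - k w else 0)"
    using assms by (intro sum.cong refl) (simp add: pairE_Estar)
  also have "\<dots> = - k w" using assms by simp
  finally show ?thesis .
qed

lemma supp_in_Estar_sum:
  assumes "finite S" "neg_definite S Adj e"
  shows "supp_in S (\<lambda>u. \<Sum>v\<in>T. k v * Estar S Adj e v u)"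
  using supp_in_Estar[OF assms] by (simp add: supp_in_def)

lemma zcoef_supp:
  assumes "finite S" "neg_definite S Adj e" "zcoef S Adj e l \<noteq> 0"
  shows "supp_in S l"
proof -
  have "{k :: 'a \<Rightarrow> nat. (\<forall>v. v \<notin> S \<longrightarrow> k v = 0) \<and>
              (\<lambda>u. \<Sum>v\<in>S. of_nat (k v) * Estar S Adj e v u) = l} \<noteq> {}"
    using assms(3) unfolding zcoef_def by (metis (no_types, lifting) sum.empty)
  then show ?thesis using supp_in_Estar_sum[OF assms(1,2)] by auto
qed

text \<open>Pairing with \<open>E_v\<close> recovers the exponent at \<open>v\<close>, so the only
  candidate tuple is \<open>k\<close>. If some \<open>k v\<close> is negative, no tuple exists and
  both sides vanish.\<close>

lemma zcoef_eq:
  assumes "finite S" "neg_definite S Adj e" "supp_in S l"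
    and k: "\<And>v. v \<in> S \<Longrightarrow> - pairE S l v = of_int (k v)"
  shows "zcoef S Adj e l = (\<Prod>v\<in>S. binom_coef (int (valency S Adj v) - 2) (k v))"
proof -
  let ?N = "{n :: 'a \<Rightarrow> nat. (\<forall>v. v \<notin> S \<longrightarrow> n v = 0) \<and>
              (\<lambda>u. \<Sum>v\<in>S. of_nat (n v) * Estar S Adj e v u) = l}"
  have N: "n \<in> ?N \<longleftrightarrow> (\<forall>v. v \<notin> S \<longrightarrow> n v = 0) \<and> (\<forall>v\<in>S. int (n v) = k v)" for n
  proof -
    have p: "pairE S (\<lambda>u. \<Sum>v\<in>S. of_nat (n v) * Estar S Adj e v u) w = - of_nat (n w)" if "w \<in> S" for w
      by (rule pairE_Estar_sum[OF assms(1,2) that])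
    have "(\<lambda>u. \<Sum>v\<in>S. of_nat (n v) * Estar S Adj e v u) = l \<longleftrightarrow> (\<forall>v\<in>S. int (n v) = k v)"
    proof
      assume l: "(\<lambda>u. \<Sum>v\<in>S. of_nat (n v) * Estar S Adj e v u) = l"
      show "\<forall>v\<in>S. int (n v) = k v"
      proof
        fix v assume "v \<in> S"
        then have "of_int (int (n v)) = (of_int (k v) :: rat)" using p k l by fastforce
        then show "int (n v) = k v" by (simp only: of_int_eq_iff)
      qed
    next
      assume *: "\<forall>v\<in>S. int (n v) = k v"
      show "(\<lambda>u. \<Sum>v\<in>S. of_nat (n v) * Estar S Adj e v u) = l"
      proof (rule pairE_unique[OF assms(2) supp_in_Estar_sum[OF assms(1,2)] assms(3)])
        fix w assume w: "w \<in> S"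
        have "(of_nat (n w) :: rat) = of_int (k w)" using * w by (metis of_int_of_nat_eq)
        then show "pairE S (\<lambda>u. \<Sum>v\<in>S. of_nat (n v) * Estar S Adj e v u) w = pairE S l w"
          using p[OF w] k[OF w] by simp
      qed
    qed
    then show ?thesis by auto
  qed
  show ?thesis
  proof (cases "\<forall>v\<in>S. 0 \<le> k v")
    case True
    define n0 where "n0 v = (if v \<in> S then nat (k v) else 0)" for v
    have "?N = {n0}"
    proof (intro set_eqI iffI)
      fix n assume "n \<in> ?N"
      then have "n = n0" using N[of n] by (fastforce simp: n0_def fun_eq_iff)
      then show "n \<in> {n0}" by simp
    next
      fix n assume "n \<in> {n0}"
      then show "n \<in> ?N" using N[of n0] True by (auto simp: n0_def)
    qed
    then have "zcoef S Adj e l =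
        (\<Prod>v\<in>S. (-1) ^ n0 v * ((of_int (int (valency S Adj v) - 2) :: rat) gchoose n0 v))"
      unfolding zcoef_def by simp
    also have "\<dots> = (\<Prod>v\<in>S. binom_coef (int (valency S Adj v) - 2) (k v))"
      using True by (intro prod.cong) (auto simp: binom_coef_def n0_def)
    finally show ?thesis .
  next
    case False
    then obtain v where v: "v \<in> S" "k v < 0" by auto
    have "n \<notin> ?N" for n
    proof
      assume "n \<in> ?N"
      then have "int (n v) = k v" using N[of n] v by blast
      then show False using v by simp
    qed
    then have "?N = {}" by blast
    then have "zcoef S Adj e l = 0" unfolding zcoef_def by (simp only: sum.empty)
    moreover have "(\<Prod>v\<in>S. binom_coef (int (valency S Adj v) - 2) (k v)) = 0"
      using v assms(1) by (intro prod_zero bexI[of _ v]) auto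
    ultimately show ?thesis by simp
  qed
qed

subsection \<open>Counting functions as sums over the lattice\<close>

text \<open>The coefficient of \<open>Z\<close> at \<open>l0 + y\<close>, where \<open>a\<close>
  lists the coordinates of \<open>l0\<close> in the dual basis.\<close>

definition term_at :: "'a set \<Rightarrow> ('a \<Rightarrow> int) \<Rightarrow> ('a \<Rightarrow> int) \<Rightarrow> rat" where
  "term_at S a y = (\<Prod>v\<in>S. binom_coef (int (valency S Adj v) - 2) (a v - pairE S y v))"

definition offsets :: "'a set \<Rightarrow> ('a \<Rightarrow> int) \<Rightarrow> 'a set \<Rightarrow> ('a \<Rightarrow> int) set" where
  "offsets S a I = {y. (\<forall>v. v \<notin> S \<longrightarrow> y v = 0) \<and> term_at S a y \<noteq> 0 \<and> \<not> (\<forall>v\<in>I. 0 \<le> y v)}"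

text \<open>Elements in the class of \<open>x\<close> differ from \<open>x\<close> by an integer
  vector, so the floor in \<open>sub\<close> is exact; outside \<open>S\<close> both vectors
  vanish.\<close>

lemma QcountI_eq:
  assumes fin: "finite S" and nd: "neg_definite S Adj e" and IS: "I \<subseteq> S"
    and x: "supp_in S x" and a: "\<And>v. v \<in> S \<Longrightarrow> dcoef S Adj e x v = of_int (a v)"
  shows "QcountI S Adj e I x = (\<Sum>y\<in>offsets S a I. term_at S a y)"
proof -
  define L where "L = {l. zcoef S Adj e l \<noteq> 0 \<and> same_class S l x \<and> \<not> (\<forall>v\<in>I. x v \<le> l v)}"
  define add where "add y = (\<lambda>v. x v + of_int (y v))" for y :: "'a \<Rightarrow> int"
  define sub where "sub l = (\<lambda>v. \<lfloor>l v - x v\<rfloor>)" for l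
  have z: "zcoef S Adj e (add y) = term_at S a y" if "\<And>v. v \<notin> S \<Longrightarrow> y v = 0" for y
    unfolding term_at_def
  proof (rule zcoef_eq[OF fin nd])
    show "supp_in S (add y)" using x that by (simp add: supp_in_def add_def)
    fix v assume v: "v \<in> S"
    have "- pairE S x v = of_int (a v)" using a[OF v] fin v by (simp add: dcoef_def ip_Ebas)
    then show "- pairE S (add y) v = of_int (a v - pairE S y v)"
      by (simp add: add_def pairE_add of_int_pairE)
  qed
  have "(\<Sum>l\<in>L. zcoef S Adj e l) = (\<Sum>y\<in>offsets S a I. term_at S a y)"
  proof (rule sum.reindex_bij_witness[where i = add and j = sub])
    fix l assume l: "l \<in> L"
    then have "supp_in S l" using zcoef_supp[OF fin nd] by (auto simp: L_def)
    then have l0: "l v = 0" "x v = 0" if "v \<notin> S" for v using that x by (auto simp: supp_in_def)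
    have "x v + of_int \<lfloor>l v - x v\<rfloor> = l v" for v
    proof -
      have "l v - x v \<in> \<int>" using l l0 by (cases "v \<in> S") (auto simp: L_def same_class_def)
      then show ?thesis by (metis Ints_cases add_diff_cancel_left' diff_add_cancel floor_of_int add.commute)
    qed
    then show al: "add (sub l) = l" by (simp add: add_def sub_def)
    have s0: "sub l v = 0" if "v \<notin> S" for v using l0 that by (simp add: sub_def)
    have zl: "zcoef S Adj e l = term_at S a (sub l)" using z[of "sub l"] s0 al by simp
    then show "term_at S a (sub l) = zcoef S Adj e l" by simp
    have "x v \<le> l v \<longleftrightarrow> 0 \<le> sub l v" for v by (simp add: sub_def)
    then show "sub l \<in> offsets S a I" using l s0 zl by (simp add: offsets_def L_def)
  next
    fix y assume y: "y \<in> offsets S a I"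
    show "sub (add y) = y" by (simp add: sub_def add_def)
    have "zcoef S Adj e (add y) = term_at S a y" using y by (intro z) (auto simp: offsets_def)
    then show "add y \<in> L" using y by (simp add: L_def offsets_def same_class_def add_def)
  qed
  then show ?thesis by (simp add: QcountI_def L_def)
qed

section \<open>Bounds on the coordinates of relevant lattice points\<close>

text \<open>On \<open>S\<close>, \<open>d\<close> is the sum of the dual basis vectors and
  \<open>n\<close> dominates all \<open>a v\<close>. Where \<open>y + n d\<close> is negative, so is
  \<open>y\<close>, and the pairing is at most \<open>a w - n \<le> 0\<close>. The maximum principle
  yields \<open>y \<ge> - n d\<close>.\<close>

lemma coordinates_bounded_below:
  assumes fin: "finite S" and nd: "neg_definite S Adj e"
  shows "\<exists>c\<ge>0. \<forall>y :: 'a \<Rightarrow> int. (\<forall>v\<in>S. y v < 0 \<longrightarrow> pairE S y v \<le> a v) \<longrightarrow> (\<forall>v\<in>S. - c \<le> y v)"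
proof -
  obtain d :: "'a \<Rightarrow> rat" where d: "\<forall>w\<in>S. pairE S d w = -1"
    using pairE_solvable[OF fin nd, of "\<lambda>_. -1"] by auto
  have d0: "0 \<le> d v" if "v \<in> S" for v
    by (rule maximum_principle[OF nd _ that]) (use d in auto)
  define n where "n = (\<Sum>v\<in>S. \<bar>a v\<bar>)"
  have n: "a v \<le> n" "0 \<le> n" if "v \<in> S" for v
  proof -
    have "\<bar>a v\<bar> \<le> n" unfolding n_def using fin that by (intro member_le_sum) auto
    then show "a v \<le> n" "0 \<le> n" by auto
  qed
  define c where "c = (\<Sum>v\<in>S. \<lceil>of_int n * d v\<rceil>)"
  have nd0: "0 \<le> \<lceil>of_int n * d v\<rceil>" if "v \<in> S" for v
  proof -
    have "0 \<le> of_int n * d v" using d0[OF that] n(2)[OF that] by simp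
    then show ?thesis by linarith
  qed
  have c: "of_int n * d v \<le> of_int c" if "v \<in> S" for v
  proof -
    have "\<lceil>of_int n * d v\<rceil> \<le> c" unfolding c_def using fin that nd0 by (intro member_le_sum) auto
    then show ?thesis by linarith
  qed
  show ?thesis
  proof (intro exI[of _ c] conjI allI impI ballI)
    show "0 \<le> c" unfolding c_def using nd0 by (intro sum_nonneg)
    fix y v assume y: "\<forall>v\<in>S. y v < 0 \<longrightarrow> pairE S y v \<le> a v" and v: "v \<in> S"
    have "0 \<le> of_int (y v) + of_int n * d v"
    proof (rule maximum_principle[OF nd _ v])
      fix w assume w: "w \<in> S" "of_int (y w) + of_int n * d w < 0"
      have "0 \<le> of_int n * d w" using d0[OF w(1)] n(2)[OF w(1)] by simp
      then have "of_int (y w) < (0::rat)" using w(2) by linarith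
      then have "pairE S y w \<le> n" using y w(1) n(1)[OF w(1)] by fastforce
      then have "of_int (pairE S y w) \<le> (of_int n :: rat)" by (simp only: of_int_le_iff)
      then show "pairE S (\<lambda>v. of_int (y v) + of_int n * d v) w \<le> 0"
        using d w(1) by (simp add: pairE_add pairE_scale of_int_pairE)
    qed
    then have "of_int (- c) \<le> (of_int (y v) :: rat)" using c[OF v] by simp
    then show "- c \<le> y v" by (simp only: of_int_le_iff)
  qed
qed

text \<open>Induction along the path. Across an edge from \<open>v\<close> to \<open>w\<close>, the
  pairing \<open>(y, E_w)\<close> contains \<open>y v\<close> with coefficient 1. If
  \<open>y v\<close> is huge, \<open>y w\<close> is not, and all coordinates are bounded below, this
  pairing exceeds \<open>a w\<close>.\<close>

lemma large_coordinate_propagates: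
  assumes fin: "finite S" and "reach S Adj u v" "u \<in> S"
  shows "\<exists>r. \<forall>y :: 'a \<Rightarrow> int. \<forall>b\<ge>r. (\<forall>w\<in>S. pairE S y w \<le> a w \<or> b \<le> y w) \<longrightarrow>
    (\<forall>w\<in>S. - c \<le> y w) \<longrightarrow> r \<le> y u \<longrightarrow> r' \<le> y v"
  using assms(2) unfolding reach_def
proof (induction arbitrary: r' rule: rtranclp_induct)
  case base
  then show ?case by (intro exI[of _ r']) auto
next
  case (step v w)
  \<comment> \<open>The middle terms absorb the most negative contributions of
    \<open>e w * y w\<close>, with \<open>- c \<le> y w < r'\<close>, and of at most
    \<open>card S\<close> other vertices. The maximum with \<open>r'\<close> settles the alternative
    \<open>b \<le> y w\<close>.\<close>
  define r'' where "r'' = max r' (\<bar>a w\<bar> + \<bar>e w\<bar> * (\<bar>c\<bar> + \<bar>r'\<bar>) + int (card S) * \<bar>c\<bar> + 1)"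
  obtain r where r: "\<forall>y. \<forall>b\<ge>r. (\<forall>w\<in>S. pairE S y w \<le> a w \<or> b \<le> y w) \<longrightarrow>
    (\<forall>w\<in>S. - c \<le> y w) \<longrightarrow> r \<le> y u \<longrightarrow> r'' \<le> y v"
    using step.IH[of r''] by auto
  show ?case
  proof (intro exI[of _ "max r r''"] allI impI)
    fix y b assume b: "max r r'' \<le> b" and y: "\<forall>w\<in>S. pairE S y w \<le> a w \<or> b \<le> y w"
      "\<forall>w\<in>S. - c \<le> y w" "max r r'' \<le> y u"
    have yv: "r'' \<le> y v" using r b y by auto
    show "r' \<le> y w"
    proof (rule ccontr)
      assume n: "\<not> r' \<le> y w"
      have w: "w \<in> S" "v \<in> S" "Adj v w" "v \<noteq> w" using step.hyps irr by auto
      have "\<not> b \<le> y w" using n b by (auto simp: r''_def)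
      then have le: "pairE S y w \<le> a w" using y(1) w by auto
      have "pairE S y w = y w * e w + (y v + (\<Sum>x\<in>S - {w} - {v}. y x * imat Adj e x w))"
        using fin w by (simp add: pairE_def sum.remove[of S w] sum.remove[of "S - {w}" v] imat_def)
      moreover have "- (\<bar>e w\<bar> * (\<bar>c\<bar> + \<bar>r'\<bar>)) \<le> y w * e w"
      proof -
        have "\<bar>y w\<bar> \<le> \<bar>c\<bar> + \<bar>r'\<bar>" using n y(2) w(1) by (smt (verit))
        then have "\<bar>y w * e w\<bar> \<le> \<bar>e w\<bar> * (\<bar>c\<bar> + \<bar>r'\<bar>)"
          by (simp add: abs_mult mult.commute mult_left_mono)
        then show ?thesis by linarith
      qed
      moreover have "- (int (card S) * \<bar>c\<bar>) \<le> (\<Sum>x\<in>S - {w} - {v}. y x * imat Adj e x w)"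
      proof -
        have "- (int (card S) * \<bar>c\<bar>) \<le> (\<Sum>x\<in>S - {w} - {v}. - \<bar>c\<bar>)"
        proof -
          have "card (S - {w} - {v}) \<le> card S" using fin by (intro card_mono) auto
          then show ?thesis by (simp add: mult_right_mono)
        qed
        also have "\<dots> \<le> (\<Sum>x\<in>S - {w} - {v}. y x * imat Adj e x w)"
        proof (intro sum_mono)
          fix x assume x: "x \<in> S - {w} - {v}"
          then have "- c \<le> y x" using y(2) by auto
          then show "- \<bar>c\<bar> \<le> y x * imat Adj e x w" using x by (auto simp: imat_def)
        qed
        finally show ?thesis .
      qed
      moreover have "\<bar>a w\<bar> + \<bar>e w\<bar> * (\<bar>c\<bar> + \<bar>r'\<bar>) + int (card S) * \<bar>c\<bar> + 1 \<le> y v"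
        using yv by (simp add: r''_def)
      ultimately show False using le by linarith
    qed
  qed
qed

text \<open>The hypothesis on \<open>y\<close> permits a pairing above \<open>a v\<close> only where
  \<open>y v\<close> has reached \<open>\<beta>\<close>. Read backwards: a point with one coordinate
  at least \<open>\<beta>\<close> and another negative has a vertex below \<open>\<beta>\<close>
  whose pairing exceeds \<open>a\<close>.\<close>

lemma coordinates_eventually_nonneg:
  assumes fin: "finite S" and nd: "neg_definite S Adj e"
    and conn: "\<And>v w. v \<in> S \<Longrightarrow> w \<in> S \<Longrightarrow> reach S Adj v w"
  shows "\<exists>b c. 0 \<le> b \<and> 0 \<le> c \<and> (\<forall>\<beta>\<ge>b. \<forall>y :: 'a \<Rightarrow> int. (\<forall>v\<in>S. pairE S y v \<le> a v \<or> \<beta> \<le> y v) \<longrightarrow>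
     (\<forall>v\<in>S. - c \<le> y v) \<and> ((\<exists>v\<in>S. \<beta> \<le> y v) \<longrightarrow> (\<forall>v\<in>S. 0 \<le> y v)))"
proof -
  obtain c where c: "0 \<le> c" "\<And>y :: 'a \<Rightarrow> int. (\<forall>v\<in>S. y v < 0 \<longrightarrow> pairE S y v \<le> a v) \<Longrightarrow> (\<forall>v\<in>S. - c \<le> y v)"
    using coordinates_bounded_below[OF fin nd, of a] by blast
  have "\<forall>p\<in>S \<times> S. \<exists>r. \<forall>y :: 'a \<Rightarrow> int. \<forall>b\<ge>r. (\<forall>w\<in>S. pairE S y w \<le> a w \<or> b \<le> y w) \<longrightarrow>
    (\<forall>w\<in>S. - c \<le> y w) \<longrightarrow> r \<le> y (fst p) \<longrightarrow> 0 \<le> y (snd p)"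
    using large_coordinate_propagates[OF fin conn, where a = a and c = c and r' = 0] by auto
  then obtain R where R: "\<forall>p\<in>S \<times> S. \<forall>y :: 'a \<Rightarrow> int. \<forall>b\<ge>R p. (\<forall>w\<in>S. pairE S y w \<le> a w \<or> b \<le> y w) \<longrightarrow>
    (\<forall>w\<in>S. - c \<le> y w) \<longrightarrow> R p \<le> y (fst p) \<longrightarrow> 0 \<le> y (snd p)"
    by (rule bchoice[THEN exE])
  \<comment> \<open>The sum dominates the finitely many thresholds, one for each pair of source and
    target.\<close>
  define b where "b = (\<Sum>p\<in>S \<times> S. \<bar>R p\<bar>)"
  have b: "R p \<le> b" if "p \<in> S \<times> S" for p
  proof -
    have "\<bar>R p\<bar> \<le> b" unfolding b_def using fin that by (intro member_le_sum) auto
    then show ?thesis by simp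
  qed
  have b0: "0 \<le> b" unfolding b_def by (intro sum_nonneg) auto
  show ?thesis
  proof (rule exI[of _ b], rule exI[of _ c], intro conjI allI impI)
    fix \<beta> and y :: "'a \<Rightarrow> int" assume \<beta>: "b \<le> \<beta>" and y: "\<forall>v\<in>S. pairE S y v \<le> a v \<or> \<beta> \<le> y v"
    show yc: "\<forall>v\<in>S. - c \<le> y v"
    proof (rule c(2), intro ballI impI)
      fix v assume "v \<in> S" "y v < 0"
      then show "pairE S y v \<le> a v" using y \<beta> b0 by fastforce
    qed
    assume "\<exists>v\<in>S. \<beta> \<le> y v"
    then obtain u where u: "u \<in> S" "\<beta> \<le> y u" by auto
    show "\<forall>v\<in>S. 0 \<le> y v"
    proof
      fix v assume v: "v \<in> S"
      have "R (u, v) \<le> \<beta>" using b[of "(u, v)"] u v \<beta> by auto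
      then show "0 \<le> y v" using R[rule_format, of "(u, v)" \<beta> y] u v y yc by auto
    qed
  qed (use b0 c in auto)
qed

subsection \<open>The potential\<close>

text \<open>This is \<open>chi(l0 + y) - chi(l0)\<close> for the Riemann-Roch function
  \<open>chi(x) = - (x, x + K) / 2\<close> with \<open>(K, E_v) = - e v - 2\<close>. The term
  \<open>e v / 2\<close> cancels the half self-intersection that a step by \<open>E_v\<close>
  produces.\<close>

definition potential :: "'a set \<Rightarrow> ('a \<Rightarrow> int) \<Rightarrow> ('a \<Rightarrow> int) \<Rightarrow> rat" where
  "potential S a y = (\<Sum>v\<in>S. (of_int (a v) + 1 + of_int (e v) / 2) * of_int (y v))
     - (\<Sum>v\<in>S. of_int (y v) * of_int (pairE S y v)) / 2"

lemma pairE_int_upd: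
  fixes y :: "'a \<Rightarrow> int"
  assumes "finite S" "v \<in> S"
  shows "pairE S (y(v := y v + 1)) w = pairE S y w + imat Adj e v w"
  using assms by (simp add: pairE_def sum.remove[of S v] distrib_right)

lemma potential_step:
  assumes "finite S" "v \<in> S"
  shows "potential S a (y(v := y v + 1)) = potential S a y + of_int (a v - pairE S y v + 1)"
proof -
  let ?y = "y(v := y v + 1)"
  have "(\<Sum>w\<in>S. ?y w * pairE S ?y w) = (\<Sum>w\<in>S. y w * pairE S ?y w) + pairE S ?y v"
    using assms by (simp add: sum.remove[of S v] distrib_right)
  moreover have "(\<Sum>w\<in>S. y w * pairE S ?y w) = (\<Sum>w\<in>S. y w * pairE S y w) + (\<Sum>w\<in>S. y w * imat Adj e v w)"
    by (simp only: pairE_int_upd[OF assms] distrib_left sum.distrib)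
  moreover have "(\<Sum>w\<in>S. y w * imat Adj e v w) = pairE S y v"
    unfolding pairE_def by (subst imat_sym) simp
  moreover have "pairE S ?y v = pairE S y v + e v"
    using pairE_int_upd[OF assms, of y v] by (simp add: imat_def)
  ultimately have "(\<Sum>w\<in>S. ?y w * pairE S ?y w) = (\<Sum>w\<in>S. y w * pairE S y w) + 2 * pairE S y v + e v"
    by linarith
  then have "(of_int (\<Sum>w\<in>S. ?y w * pairE S ?y w) :: rat) = of_int ((\<Sum>w\<in>S. y w * pairE S y w) + 2 * pairE S y v + e v)"
    by (simp only:)
  then have "(\<Sum>w\<in>S. of_int (?y w) * of_int (pairE S ?y w) :: rat) =
      (\<Sum>w\<in>S. of_int (y w) * of_int (pairE S y w)) + 2 * of_int (pairE S y v) + of_int (e v)"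
    by simp
  moreover have "(\<Sum>w\<in>S. (of_int (a w) + 1 + of_int (e w) / 2) * of_int (?y w) :: rat) =
      (\<Sum>w\<in>S. (of_int (a w) + 1 + of_int (e w) / 2) * of_int (y w)) + (of_int (a v) + 1 + of_int (e v) / 2)"
    using assms by (simp add: sum.remove[of S v] distrib_left)
  ultimately show ?thesis unfolding potential_def by (simp add: field_simps)
qed

lemma potential_0: "potential S a (\<lambda>_. 0) = 0"
  by (simp add: potential_def)

text \<open>Each neighbour of \<open>v\<close> in \<open>K\<close> raises the pairing with
  \<open>E_v\<close> by one. This is the increment condition of \<open>alt_max_grown_tree\<close>
  with \<open>k v = a v - pairE S y v\<close>.\<close>

lemma potential_shift_insert:
  assumes "finite S" "v \<in> S" "K \<subseteq> S - {v}"
  shows "potential S a (shift y (insert v K)) = potential S a (shift y K) +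
    of_int ((a v - pairE S y v) + 1 - int (card {w \<in> K. Adj v w}))"
proof -
  have "pairE S (shift y K) v = pairE S y v + (\<Sum>u\<in>S. of_bool (u \<in> K) * imat Adj e u v)"
    by (simp add: shift_def pairE_add pairE_def distrib_right sum.distrib)
  also have "(\<Sum>u\<in>S. of_bool (u \<in> K) * imat Adj e u v) = (\<Sum>u\<in>K. imat Adj e u v)"
    using assms by (intro sum.mono_neutral_cong_right) auto
  also have "\<dots> = (\<Sum>u\<in>K. if Adj v u then 1 else 0)"
    using assms sym by (intro sum.cong) (auto simp: imat_def)
  also have "\<dots> = int (card {w \<in> K. Adj v w})"
    using assms finite_subset[of K S] by (subst sum.If_cases) (auto simp: Int_def)
  finally have "pairE S (shift y K) v = pairE S y v + int (card {w \<in> K. Adj v w})" .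
  moreover have "shift y (insert v K) = (shift y K)(v := shift y K v + 1)"
    using assms by (intro shift_insert) auto
  ultimately show ?thesis using potential_step[OF assms(1,2), of a "shift y K"] by simp
qed

lemma term_at_eq_alt_max:
  assumes "grown_tree Adj S"
  shows "term_at S a y = alt_max (\<lambda>K. potential S a (shift y K)) S"
proof -
  have "finite S" using grown_tree_finite[OF assms] by simp
  then show ?thesis
    unfolding term_at_def
    by (intro alt_max_grown_tree[OF assms sym irr, symmetric] potential_shift_insert)
qed

subsection \<open>Collapse of boxes\<close>

text \<open>Since \<open>(u, u) < 0\<close> for nonzero \<open>u\<close>, some \<open>v\<close> has
  \<open>u v > 0\<close> and \<open>(u, E_v) \<le> -1\<close>. Points \<open>y \<le> u\<close> one
  step below the top in direction \<open>v\<close> satisfy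
  \<open>(y, E_v) \<le> (u, E_v) - e v \<le> -1 - e v\<close>. With \<open>a v \<ge> - e v\<close>
  the last step does not decrease the potential, so the top layer can go.\<close>

lemma cube_sum_potential_contract:
  assumes fin: "finite S" and nd: "neg_definite S Adj e"
    and a: "\<And>v. v \<in> S \<Longrightarrow> - e v \<le> a v"
    and l: "\<And>v. l v \<le> 0" "\<And>v. v \<notin> S \<Longrightarrow> l v = 0"
    and u: "\<And>v. 0 \<le> u v" "\<And>v. v \<notin> S \<Longrightarrow> u v = 0"
  shows "cube_sum (potential S a) l u = cube_sum (potential S a) l (\<lambda>_. 0)"
  using u
proof (induction "\<Sum>w\<in>S. nat (u w)" arbitrary: u rule: less_induct)
  case less
  show ?case
  proof (cases "\<exists>v\<in>S. u v \<noteq> 0")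
    case True
    then have "(\<Sum>v\<in>S. of_int (u v) * pairE S (\<lambda>v. of_int (u v)) v) < (0::rat)"
      by (intro negdef_rat[OF nd]) auto
    then have "(of_int (\<Sum>v\<in>S. u v * pairE S u v) :: rat) < 0"
      by (simp add: of_int_pairE)
    then have "(\<Sum>v\<in>S. u v * pairE S u v) < 0" by (simp only: of_int_less_0_iff)
    then obtain v where v: "v \<in> S" "u v * pairE S u v < 0"
      by (meson linorder_not_le sum_nonneg)
    then have uv: "0 < u v" "pairE S u v < 0"
      using less.prems(1)[of v] by (auto simp: mult_less_0_iff)
    let ?u = "u(v := u v - 1)"
    have "cube_sum (potential S a) l u = cube_sum (potential S a) l ?u"
    proof (rule cube_sum_remove_top_layer[OF fin])
      show "l w = u w" if "w \<notin> S" for w using l less.prems that by simp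
      show "l v < u v" using l(1)[of v] uv(1) by simp
      fix y assume y: "y \<in> {l..u}" "y v = u v - 1"
      have "pairE S y v \<le> pairE S ?u v"
        using y by (intro pairE_mono) (auto simp: le_fun_def)
      also have "pairE S ?u v = pairE S u v - e v"
        using pairE_int_upd[OF fin v(1), of ?u v] by (simp add: imat_def)
      finally have "0 \<le> a v - pairE S y v + 1" using uv(2) a[OF v(1)] by simp
      then have "(0::rat) \<le> of_int (a v - pairE S y v + 1)" by (simp only: of_int_0_le_iff)
      then show "potential S a y \<le> potential S a (y(v := u v))"
        using potential_step[OF fin v(1), of a y] y(2) by simp
    qed
    also have "\<dots> = cube_sum (potential S a) l (\<lambda>_. 0)"
    proof (rule less.hyps)
      show "(\<Sum>w\<in>S. nat (?u w)) < (\<Sum>w\<in>S. nat (u w))"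
        using fin v uv by (intro sum_strict_mono_ex1) auto
    qed (use less.prems v uv in auto)
    finally show ?thesis .
  next
    case False
    then have "u = (\<lambda>_. 0)" using less.prems by auto
    then show ?thesis by simp
  qed
qed

text \<open>The lower corners on the far faces of a large box contribute nothing: such a point with a
  negative coordinate has a direction \<open>v\<close> in which the potential does not increase, and the
  cubes \<open>J\<close> and \<open>insert v J\<close> cancel. The rest of the box collapses onto its nonpositive part.\<close>

lemma offsets_sum_eq_cube_sum:
  assumes tree: "grown_tree Adj S" and nd: "neg_definite S Adj e"
    and conn: "\<And>v w. v \<in> S \<Longrightarrow> w \<in> S \<Longrightarrow> reach S Adj v w"
    and a: "\<And>v. v \<in> S \<Longrightarrow> - e v \<le> a v"
  shows "finite (offsets S a S) \<and> (\<exists>c0\<ge>0. \<forall>c\<ge>c0. \<forall>A\<subseteq>S.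
    (\<Sum>y\<in>offsets S a S - offsets S a (S - A). term_at S a y) =
      cube_sum (potential S a) (\<lambda>v. if v \<in> A then - c else 0) (\<lambda>_. 0))"
proof -
  have fin: "finite S" using grown_tree_finite[OF tree] by simp
  obtain b c0 where b0: "0 \<le> b" and c0: "0 \<le> c0"
    and grow: "\<And>y :: 'a \<Rightarrow> int. (\<forall>v\<in>S. pairE S y v \<le> a v \<or> b \<le> y v) \<Longrightarrow>
     (\<forall>v\<in>S. - c0 \<le> y v) \<and> ((\<exists>v\<in>S. b \<le> y v) \<longrightarrow> (\<forall>v\<in>S. 0 \<le> y v))"
    using coordinates_eventually_nonneg[OF fin nd conn, of a] by blast
  \<comment> \<open>A point with nonzero coefficient and a negative coordinate stays strictly below
    \<open>b\<close>, so the full cube above it fits into the box.\<close>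
  define u where "u v = (if v \<in> S then b else 0)" for v
  have off0: "y v = 0" if "y \<in> offsets S a S" "v \<notin> S" for y v
    using that by (auto simp: offsets_def)
  have offb: "- c0 \<le> y v" "y v < b" if y: "y \<in> offsets S a S" and v: "v \<in> S" for y v
  proof -
    have "pairE S y w \<le> a w" if w: "w \<in> S" for w
    proof (rule ccontr)
      assume "\<not> pairE S y w \<le> a w"
      then have "term_at S a y = 0"
        unfolding term_at_def using fin w by (intro prod_zero bexI[of _ w]) auto
      then show False using y by (simp add: offsets_def)
    qed
    then have "(\<forall>v\<in>S. - c0 \<le> y v) \<and> ((\<exists>v\<in>S. b \<le> y v) \<longrightarrow> (\<forall>v\<in>S. 0 \<le> y v))"
      by (intro grow) auto
    then show "- c0 \<le> y v" "y v < b" using y v by (auto simp: offsets_def not_le[symmetric])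
  qed
  have "finite (offsets S a S)"
  proof (rule finite_subset)
    show "offsets S a S \<subseteq> {\<lambda>v. if v \<in> S then - c0 else 0..u}"
      using off0 offb by (force simp: le_fun_def u_def)
    show "finite {\<lambda>v. if v \<in> S then - c0 else 0..u}"
      by (rule finite_box[OF fin]) (simp add: u_def)
  qed
  moreover have "(\<Sum>y\<in>offsets S a S - offsets S a (S - A). term_at S a y) =
      cube_sum (potential S a) (\<lambda>v. if v \<in> A then - c else 0) (\<lambda>_. 0)"
    if c: "c0 \<le> c" and A: "A \<subseteq> S" for c A
  proof -
    let ?W = "potential S a" and ?o = "\<lambda>_::'a. 0::int"
    let ?f = "\<lambda>(y, J). (-1) ^ (card J + 1) * cube_max ?W y J"
    define l where "l v = (if v \<in> A then - c else 0)" for v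
    \<comment> \<open>The directions in which a unit step from \<open>y\<close> stays in the box;
      off the far faces this is all of \<open>S\<close>.\<close>
    define T where "T y = {v \<in> S. y v < b}" for y :: "'a \<Rightarrow> int"
    define Y where "Y = {y \<in> {l..u}. \<not> ?o \<le> y}"
    have l: "l v \<le> 0" "v \<notin> S \<Longrightarrow> l v = 0" for v using c c0 A by (auto simp: l_def)
    have u: "0 \<le> u v" "v \<notin> S \<Longrightarrow> u v = 0" for v using b0 by (auto simp: u_def)
    have finY: "finite Y"
      using finite_box[OF fin, of l u] l(2) u(2) by (auto simp: Y_def intro: finite_subset[of _ "{l..u}"])
    have finc: "finite (cubes l u)" by (rule finite_cubes[OF fin]) (use l u in auto)
    have y_off: "y v = 0" if "y \<in> {l..u}" "v \<notin> S" for y v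
    proof -
      have "l v \<le> y v" "y v \<le> u v" using that by (auto simp: le_fun_def)
      then show ?thesis using l(2) u(2) that(2) by force
    qed
    have sub: "cubes ?o u \<subseteq> cubes l u"
    proof -
      have "l \<le> ?o" using l(1) by (simp add: le_fun_def)
      then show ?thesis unfolding cubes_def using order.trans[of l ?o] by blast
    qed
    \<comment> \<open>Cells outside the nonnegative part are grouped by lower corner, so that each
      group sums to an \<open>alt_max\<close> over \<open>T y\<close>.\<close>
    have "cubes l u - cubes ?o u = Sigma Y (\<lambda>y. Pow (T y))"
    proof (intro set_eqI, clarify)
      fix y J
      have "(y, J) \<in> cubes l u \<longleftrightarrow> y \<in> {l..u} \<and> J \<subseteq> T y"
      proof
        assume yJ: "(y, J) \<in> cubes l u"
        then have "y \<in> {l..u}" "J \<subseteq> S" using cubes_subset[of S l u] l u by auto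
        moreover have "y v < b" if "v \<in> J" for v
        proof -
          have "y v + 1 \<le> u v" using yJ that by (auto simp: cubes_def le_fun_def shift_def dest!: spec[of _ v])
          then show ?thesis using that \<open>J \<subseteq> S\<close> by (auto simp: u_def)
        qed
        ultimately show "y \<in> {l..u} \<and> J \<subseteq> T y" by (auto simp: T_def)
      next
        assume yJ: "y \<in> {l..u} \<and> J \<subseteq> T y"
        then have "shift y J v \<le> u v" for v
          by (cases "v \<in> J") (auto simp: le_fun_def shift_def u_def T_def)
        then show "(y, J) \<in> cubes l u" using yJ by (auto simp: cubes_def le_fun_def)
      qed
      moreover have "(y, J) \<in> cubes ?o u \<longleftrightarrow> (y, J) \<in> cubes l u \<and> ?o \<le> y"
        using sub by (auto simp: cubes_def)
      ultimately show "(y, J) \<in> cubes l u - cubes ?o u \<longleftrightarrow> (y, J) \<in> Sigma Y (\<lambda>y. Pow (T y))"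
        by (auto simp: Y_def)
    qed
    then have "cube_sum ?W l u - cube_sum ?W ?o u = sum ?f (Sigma Y (\<lambda>y. Pow (T y)))"
      unfolding cube_sum_def using sum_diff[OF finc sub, of ?f] by simp
    also have "\<dots> = (\<Sum>y\<in>Y. alt_max (\<lambda>K. ?W (shift y K)) (T y))"
      unfolding alt_max_def cube_max_def using finY fin by (subst sum.Sigma) (auto simp: T_def)
    also have "\<dots> = (\<Sum>y\<in>offsets S a S - offsets S a (S - A). term_at S a y)"
    proof (rule sum.mono_neutral_cong_right[OF finY])
      show "offsets S a S - offsets S a (S - A) \<subseteq> Y"
      proof
        fix y assume y: "y \<in> offsets S a S - offsets S a (S - A)"
        then have yS: "y \<in> offsets S a S" by simp
        have pos: "0 \<le> y v" if "v \<in> S - A" for v using y that by (auto simp: offsets_def)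
        have "l v \<le> y v" "y v \<le> u v" for v
          using off0[OF yS, of v] offb[OF yS, of v] pos[of v] c A
          by (cases "v \<in> S"; auto simp: l_def u_def)+
        moreover have "\<not> ?o \<le> y" using yS by (auto simp: offsets_def le_fun_def)
        ultimately show "y \<in> Y" by (auto simp: Y_def le_fun_def)
      qed
      have full: "alt_max (\<lambda>K. ?W (shift y K)) (T y) = term_at S a y" if "T y = S" for y
        using that term_at_eq_alt_max[OF tree, of a y] by simp
      show "alt_max (\<lambda>K. ?W (shift y K)) (T y) = term_at S a y"
        if "y \<in> offsets S a S - offsets S a (S - A)" for y
        using that offb[of y] by (intro full) (auto simp: T_def)
      show "\<forall>y\<in>Y - (offsets S a S - offsets S a (S - A)). alt_max (\<lambda>K. ?W (shift y K)) (T y) = 0"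
      proof
        fix y assume y: "y \<in> Y - (offsets S a S - offsets S a (S - A))"
        then have box: "y \<in> {l..u}" and neg: "\<not> ?o \<le> y" by (auto simp: Y_def)
        obtain v0 where v0: "v0 \<in> S" "y v0 < 0"
          using neg y_off[OF box] by (force simp: le_fun_def not_le)
        show "alt_max (\<lambda>K. ?W (shift y K)) (T y) = 0"
        proof (cases "T y = S")
          case True
          have "0 \<le> y v" if "v \<in> S - A" for v
          proof -
            have "l v \<le> y v" using box by (simp add: le_fun_def)
            then show ?thesis using that by (simp add: l_def)
          qed
          \<comment> \<open>The box makes \<open>y\<close> nonnegative off \<open>A\<close>, and
            \<open>y\<close> has a negative coordinate, so only a vanishing coefficient can exclude
            it from the offsets.\<close>
          then have "term_at S a y = 0"
            using y v0 y_off[OF box] by (force simp: offsets_def)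
          then show ?thesis using full[OF True] by simp
        next
          case False
          then have "\<exists>v\<in>S. b \<le> y v" by (auto simp: T_def not_less)
          then have "\<not> (\<forall>v\<in>S. pairE S y v \<le> a v \<or> b \<le> y v)"
            using grow[of y] v0 by force
          then obtain w where w: "w \<in> S" "a w < pairE S y w" "y w < b" by auto
          show ?thesis
          proof (rule alt_max_eq_0[of _ w])
            fix K assume "K \<subseteq> T y - {w}"
            then have "K \<subseteq> S - {w}" by (auto simp: T_def)
            from potential_shift_insert[OF fin w(1) this, of a y] w(2)
            show "?W (shift y (insert w K)) \<le> ?W (shift y K)" by simp
          qed (use w fin in \<open>auto simp: T_def\<close>)
        qed
      qed
    qed
    also have "cube_sum ?W l u = cube_sum ?W l ?o"
      using l u by (intro cube_sum_potential_contract[OF fin nd a]) auto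
    \<comment> \<open>The nonnegative part collapses to the origin, where the potential is
      0.\<close>
    also have "cube_sum ?W ?o u = 0"
      using u cube_sum_potential_contract[OF fin nd a, of "?o" u]
      by (simp add: cube_sum_point potential_0)
    finally show ?thesis by (simp add: l_def[abs_def])
  qed
  ultimately show ?thesis using c0 by blast
qed

section \<open>Additivity over the components of the complement\<close>

text \<open>No edge joins \<open>A\<close> and \<open>B\<close>, so the mixed terms of the quadratic
  form vanish.\<close>

lemma potential_Un:
  assumes "finite A" "finite B" "A \<inter> B = {}" and "\<And>v w. v \<in> A \<Longrightarrow> w \<in> B \<Longrightarrow> \<not> Adj v w"
  shows "potential (A \<union> B) a y = potential A a y + potential B a y"
proof -
  have p: "pairE (A \<union> B) y v = pairE A y v + pairE B y v" for v
    using assms by (simp add: pairE_def sum.union_disjoint)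
  have "pairE B y v = 0" if "v \<in> A" for v
    unfolding pairE_def using assms(3,4) that by (intro sum.neutral) (auto simp: imat_def dest: sym)
  moreover have "pairE A y v = 0" if "v \<in> B" for v
    unfolding pairE_def using assms that by (intro sum.neutral) (auto simp: imat_def)
  ultimately have "(\<Sum>v\<in>A \<union> B. of_int (y v) * of_int (pairE (A \<union> B) y v)) =
    (\<Sum>v\<in>A. of_int (y v) * of_int (pairE A y v)) + (\<Sum>v\<in>B. of_int (y v) * (of_int (pairE B y v)::rat))"
    using assms by (simp add: sum.union_disjoint p)
  then show ?thesis
    using assms unfolding potential_def by (simp add: sum.union_disjoint add_divide_distrib)
qed

lemma pairE_cong: "(\<And>v. v \<in> S \<Longrightarrow> y v = y' v) \<Longrightarrow> pairE S y w = pairE S y' w"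
  by (simp add: pairE_def)

lemma potential_cong:
  assumes "\<And>v. v \<in> S \<Longrightarrow> y v = y' v"
  shows "potential S a y = potential S a y'"
  using assms pairE_cong[of S y y', OF assms] by (simp add: potential_def)

lemma potential_supported:
  assumes "finite V" "A \<subseteq> V" "\<And>v. v \<notin> A \<Longrightarrow> y v = 0"
  shows "potential V a y = potential A a y"
proof -
  have "pairE V y v = pairE A y v" for v
    unfolding pairE_def using assms by (intro sum.mono_neutral_right) auto
  moreover have "sum f V = sum f A" if "\<And>v. v \<in> V - A \<Longrightarrow> f v = 0" for f :: "'a \<Rightarrow> rat"
    using assms that by (intro sum.mono_neutral_right) auto
  ultimately show ?thesis using assms(3) by (simp add: potential_def)
qed

lemma cube_sum_Union:
  assumes "finite \<C>" "\<And>C. C \<in> \<C> \<Longrightarrow> finite C" and c: "0 \<le> c"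
    and "\<And>C D. C \<in> \<C> \<Longrightarrow> D \<in> \<C> \<Longrightarrow> C \<noteq> D \<Longrightarrow> C \<inter> D = {}"
    and "\<And>C D v w. C \<in> \<C> \<Longrightarrow> D \<in> \<C> \<Longrightarrow> C \<noteq> D \<Longrightarrow> v \<in> C \<Longrightarrow> w \<in> D \<Longrightarrow> \<not> Adj v w"
  shows "cube_sum (potential (\<Union>\<C>) a) (\<lambda>v. if v \<in> \<Union>\<C> then - c else 0) (\<lambda>_. 0) =
    (\<Sum>C\<in>\<C>. cube_sum (potential C a) (\<lambda>v. if v \<in> C then - c else 0) (\<lambda>_. 0))"
  using assms(1,2,4,5)
proof (induction \<C> rule: finite_induct)
  case empty
  then show ?case by (simp add: cube_sum_point potential_0)
next
  case (insert C \<C>)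
  have disj: "C \<inter> D = {}" if "D \<in> \<C>" for D
    using insert.prems(2)[of C D] insert.hyps(2) that by auto
  have nonadj: "\<not> Adj v w" if "v \<in> C" "w \<in> \<Union>\<C>" for v w
    using insert.prems(3)[of C _ v w] insert.hyps(2) that by auto
  have fin: "finite C" "finite (\<Union>\<C>)" using insert.prems(1) insert.hyps(1) by auto
  have dU: "C \<inter> \<Union>\<C> = {}" using disj by auto
  have "cube_sum (potential (C \<union> \<Union>\<C>) a) (\<lambda>v. if v \<in> C \<union> \<Union>\<C> then - c else 0) (\<lambda>_. 0) =
      cube_sum (\<lambda>y. potential C a y + potential (\<Union>\<C>) a y) (\<lambda>v. if v \<in> C \<union> \<Union>\<C> then - c else 0) (\<lambda>_. 0)"
    using potential_Un[OF fin dU nonadj, of a] by (intro cube_sum_cong) auto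
  also have "\<dots> = cube_sum (potential C a) (\<lambda>v. if v \<in> C then - c else 0) (\<lambda>_. 0) +
      cube_sum (potential (\<Union>\<C>) a) (\<lambda>v. if v \<in> \<Union>\<C> then - c else 0) (\<lambda>_. 0)"
    by (rule cube_sum_add[OF fin dU c]) (auto intro: potential_cong)
  also have "cube_sum (potential (\<Union>\<C>) a) (\<lambda>v. if v \<in> \<Union>\<C> then - c else 0) (\<lambda>_. 0) =
    (\<Sum>C\<in>\<C>. cube_sum (potential C a) (\<lambda>v. if v \<in> C then - c else 0) (\<lambda>_. 0))"
  proof (rule insert.IH)
    show "finite D" if "D \<in> \<C>" for D
      using that by (intro insert.prems(1)) simp
    show "D \<inter> D' = {}" if "D \<in> \<C>" "D' \<in> \<C>" "D \<noteq> D'" for D D'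
      using that by (intro insert.prems(2)) simp_all
    show "\<not> Adj v w" if "D \<in> \<C>" "D' \<in> \<C>" "D \<noteq> D'" "v \<in> D" "w \<in> D'" for D D' v w
      by (rule insert.prems(3)[of D D']) (use that in simp_all)
  qed
  finally show ?case using insert.hyps by simp
qed

text \<open>Dual coordinates at the vertices of \<open>C\<close> are preserved, so one function
  \<open>a\<close> describes \<open>l0\<close> and its images in all components.\<close>

lemma dcoef_jstar:
  assumes "finite C" "neg_definite C Adj e" "v \<in> C"
  shows "dcoef C Adj e (jstar V C Adj e x) v = dcoef V Adj e x v"
  unfolding dcoef_def[of C] jstar_def
  using assms by (simp add: ip_Ebas pairE_Estar_sum)

end

section \<open>Comparison of the counting functions of the graph and of the components\<close>

lemma Qcount_eq_QcountI: "Qcount S Adj e x = QcountI S Adj e S x"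
  by (simp add: Qcount_def QcountI_def)

theorem theorem3p3:
  fixes V I :: "'a set" and Adj :: "'a \<Rightarrow> 'a \<Rightarrow> bool" and e :: "'a \<Rightarrow> int"
    and h :: "'a \<Rightarrow> rat"
  assumes tree: "is_tree V Adj"
    and negdef: "neg_definite V Adj e"
    and h: "h \<in> Ldual V Adj e"
    and I: "I \<noteq> {}" "I \<subseteq> V"
  shows "\<exists>N :: int. \<forall>l0 \<in> Ldual V Adj e. same_class V l0 h \<longrightarrow>
           (\<forall>v\<in>V. of_int N \<le> dcoef V Adj e l0 v) \<longrightarrow>
           Qcount V Adj e l0 = QcountI V Adj e I l0 +
             (\<Sum>C\<in>components (V - I) Adj. Qcount C Adj e (jstar V C Adj e l0))"
proof -
  interpret plumbing Adj e
    using tree by unfold_locales (auto simp: is_tree_def)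
  have fin: "finite V" "V \<noteq> {}" and conn: "\<And>v w. v \<in> V \<Longrightarrow> w \<in> V \<Longrightarrow> reach V Adj v w"
    using tree by (auto simp: is_tree_def)
  define \<C> where "\<C> = components (V - I) Adj"
  have fC: "finite \<C>" unfolding \<C>_def using fin by (intro finite_components) auto
  have UC: "\<Union>\<C> = V - I" unfolding \<C>_def by (rule Union_components)
  have C: "C \<subseteq> V - I" "C \<subseteq> V" "C \<noteq> {}" "finite C" "neg_definite C Adj e" "grown_tree Adj C"
    "\<And>v w. v \<in> C \<Longrightarrow> w \<in> C \<Longrightarrow> reach C Adj v w" if "C \<in> \<C>" for C
  proof -
    note facts = components_facts[OF sym that[unfolded \<C>_def]]
    show "C \<subseteq> V - I" by (rule facts(1))
    then show "C \<subseteq> V" by auto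
    then show "finite C" "neg_definite C Adj e"
      using fin negdef_subset[OF negdef] finite_subset by auto
    show "C \<noteq> {}" by (rule facts(2))
    show reachC: "reach C Adj v w" if "v \<in> C" "w \<in> C" for v w using facts(3) that by blast
    show "grown_tree Adj C"
      by (rule connected_subset_of_tree[OF tree \<open>C \<subseteq> V\<close> \<open>C \<noteq> {}\<close> reachC])
  qed
  \<comment> \<open>Contracting boxes asks for \<open>- e v \<le> a v\<close> at every vertex, in
    \<open>V\<close> and in each component; this sum dominates every \<open>- e v\<close>.\<close>
  define N where "N = (\<Sum>v\<in>V. \<bar>e v\<bar>)"
  have N: "- e v \<le> N" if "v \<in> V" for v
  proof -
    have "\<bar>e v\<bar> \<le> N" unfolding N_def using fin that by (intro member_le_sum) auto
    then show ?thesis by simp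
  qed
  show ?thesis
  proof (intro exI[of _ N] ballI impI)
    fix l0 assume l0: "l0 \<in> Ldual V Adj e" and l0N: "\<forall>v\<in>V. of_int N \<le> dcoef V Adj e l0 v"
    define a where "a v = \<lfloor>dcoef V Adj e l0 v\<rfloor>" for v
    have da: "dcoef V Adj e l0 v = of_int (a v)" if "v \<in> V" for v
    proof -
      have "dcoef V Adj e l0 v \<in> \<int>" using l0 that by (auto simp: Ldual_def dcoef_def)
      then show ?thesis by (simp add: a_def)
    qed
    have ae: "- e v \<le> a v" if "v \<in> V" for v
    proof -
      have "N \<le> a v" using l0N that by (simp add: a_def le_floor_iff)
      then show ?thesis using N[OF that] by simp
    qed
    have supp: "supp_in V l0" using l0 by (simp add: Ldual_def)
    have gV: "grown_tree Adj V" by (rule connected_subset_of_tree[OF tree subset_refl fin(2) conn])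
    obtain cV where finV: "finite (offsets V a V)" and cV: "\<And>c A. cV \<le> c \<Longrightarrow> A \<subseteq> V \<Longrightarrow>
        (\<Sum>y\<in>offsets V a V - offsets V a (V - A). term_at V a y) =
        cube_sum (potential V a) (\<lambda>v. if v \<in> A then - c else 0) (\<lambda>_. 0)" and cV0: "0 \<le> cV"
      using offsets_sum_eq_cube_sum[OF gV negdef conn ae] by auto
    have "\<forall>C\<in>\<C>. \<exists>c0. \<forall>c\<ge>c0. (\<Sum>y\<in>offsets C a C. term_at C a y) =
        cube_sum (potential C a) (\<lambda>v. if v \<in> C then - c else 0) (\<lambda>_. 0)"
    proof
      fix D assume D: "D \<in> \<C>"
      have "- e v \<le> a v" if "v \<in> D" for v using ae C(2)[OF D] that by auto
      then obtain c0 where "\<forall>c\<ge>c0. \<forall>A\<subseteq>D. (\<Sum>y\<in>offsets D a D - offsets D a (D - A). term_at D a y) =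
        cube_sum (potential D a) (\<lambda>v. if v \<in> A then - c else 0) (\<lambda>_. 0)"
        using offsets_sum_eq_cube_sum[OF C(6,5,7)[OF D], of a] by auto
      \<comment> \<open>For \<open>A = D\<close> nothing is subtracted, and the formula gives the
        whole counting sum of the component.\<close>
      moreover have "offsets D a (D - D) = {}" by (simp add: offsets_def)
      ultimately show "\<exists>c0. \<forall>c\<ge>c0. (\<Sum>y\<in>offsets D a D. term_at D a y) =
        cube_sum (potential D a) (\<lambda>v. if v \<in> D then - c else 0) (\<lambda>_. 0)"
        by (metis Diff_empty subset_refl)
    qed
    then obtain cC where cC: "\<forall>C\<in>\<C>. \<forall>c\<ge>cC C. (\<Sum>y\<in>offsets C a C. term_at C a y) =
        cube_sum (potential C a) (\<lambda>v. if v \<in> C then - c else 0) (\<lambda>_. 0)"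
      by (rule bchoice[THEN exE])
    \<comment> \<open>A common depth for \<open>V\<close> and all components, so that the box over
      \<open>V - I\<close> is the product of the component boxes.\<close>
    define c where "c = cV + (\<Sum>C\<in>\<C>. \<bar>cC C\<bar>)"
    have c: "cV \<le> c" "0 \<le> c" using cV0 by (auto simp: c_def sum_nonneg)
    have cge: "cC D \<le> c" if "D \<in> \<C>" for D
    proof -
      have "\<bar>cC D\<bar> \<le> (\<Sum>C\<in>\<C>. \<bar>cC C\<bar>)" using fC that by (intro member_le_sum) auto
      then show ?thesis using cV0 by (simp add: c_def)
    qed
    let ?l = "\<lambda>S v. if v \<in> S then - c else 0"
    have VI: "V - (V - I) = I" using I by auto
    have "Qcount V Adj e l0 - QcountI V Adj e I l0 =
        (\<Sum>y\<in>offsets V a V. term_at V a y) - (\<Sum>y\<in>offsets V a I. term_at V a y)"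
      unfolding Qcount_eq_QcountI using fin negdef supp da I by (simp add: QcountI_eq)
    \<comment> \<open>What remains are points with a negative coordinate but none on
      \<open>I\<close>: the case \<open>A = V - I\<close>.\<close>
    also have "\<dots> = (\<Sum>y\<in>offsets V a V - offsets V a (V - (V - I)). term_at V a y)"
      unfolding VI using finV I(2) by (intro sum_diff[symmetric]) (auto simp: offsets_def)
    also have "\<dots> = cube_sum (potential V a) (?l (V - I)) (\<lambda>_. 0)"
      by (rule cV) (use c in auto)
    \<comment> \<open>The box has width zero on \<open>I\<close>, so only the potential of the
      complement is seen.\<close>
    also have "\<dots> = cube_sum (potential (V - I) a) (?l (V - I)) (\<lambda>_. 0)"
    proof (rule cube_sum_cong)
      fix y assume y: "y \<in> {?l (V - I)..\<lambda>_. 0}"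
      show "potential V a y = potential (V - I) a y"
      proof (rule potential_supported[OF fin(1)])
        fix v assume "v \<notin> V - I"
        moreover have "?l (V - I) v \<le> y v" "y v \<le> 0" using y by (auto simp: le_fun_def)
        ultimately show "y v = 0" by auto
      qed auto
    qed
    also have "\<dots> = (\<Sum>C\<in>\<C>. cube_sum (potential C a) (?l C) (\<lambda>_. 0))"
      unfolding UC[symmetric]
    proof (rule cube_sum_Union[OF fC C(4) c(2)])
      show "C \<inter> D = {}" if "C \<in> \<C>" "D \<in> \<C>" "C \<noteq> D" for C D
        using components_disjoint[of Adj C "V - I" D] sym that unfolding \<C>_def by blast
      then show "\<not> Adj v w" if "C \<in> \<C>" "D \<in> \<C>" "C \<noteq> D" "v \<in> C" "w \<in> D" for C D v w
        using components_closed[of Adj C "V - I" v w] sym that C(1)[OF that(2)]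
        unfolding \<C>_def by blast
    qed
    also have "\<dots> = (\<Sum>C\<in>\<C>. Qcount C Adj e (jstar V C Adj e l0))"
    proof (rule sum.cong[OF refl])
      fix D assume D: "D \<in> \<C>"
      have "Qcount D Adj e (jstar V D Adj e l0) = (\<Sum>y\<in>offsets D a D. term_at D a y)"
        unfolding Qcount_eq_QcountI
      proof (rule QcountI_eq[OF C(4,5)[OF D] subset_refl])
        show "supp_in D (jstar V D Adj e l0)"
          unfolding jstar_def by (rule supp_in_Estar_sum[OF C(4,5)[OF D]])
        show "dcoef D Adj e (jstar V D Adj e l0) v = of_int (a v)" if "v \<in> D" for v
          using dcoef_jstar[OF C(4,5)[OF D] that] da C(2)[OF D] that by auto
      qed
      then show "cube_sum (potential D a) (?l D) (\<lambda>_. 0) = Qcount D Adj e (jstar V D Adj e l0)"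
        using cC D cge[OF D] by simp
    qed
    finally show "Qcount V Adj e l0 = QcountI V Adj e I l0 +
        (\<Sum>C\<in>components (V - I) Adj. Qcount C Adj e (jstar V C Adj e l0))"
      by (simp add: \<C>_def)
  qed
qed

end
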